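(* For all $\mu_1,\mu_2,\sigma,\sigma_1,\sigma_2\in\mathcal{P}(\mathbb{R})$, $$\mathbb{A}_\sigma(\mu_1\boxplus\mu_2)=\mathbb{A}_\sigma(\mu_1)\boxplus\mathbb{A}_\sigma(\mu_2),\qquad \mathbb{A}_{\sigma_1}\circ\mathbb{A}_{\sigma_2}=\mathbb{A}_{\sigma_2\rhd\sigma_1}\ \text{on }\mathcal{P}(\mathbb{R}).$$
   Context: For $\mu\in\mathcal{P}(\mathbb{R})$, $G_\mu(z)=\int\frac{1}{z-x}\mu(dx)$ and $F_\mu=1/G_\mu$ on the upper half-plane $\mathbb{C}^+$. $F_\mu$ has a univalent left inverse $F_\mu^{-1}$ on some truncated cone $\Gamma_{\lambda,M}=\{z\in\mathbb{C}^+:|\mathrm{Re}\,z|<\lambda\mathrm{Im}\,z,\ \mathrm{Im}\,z>M\}$, and the Voiculescu transform is $\phi_\mu(z)=F_\mu^{-1}(z)-z$ there. Additive free convolution $\boxplus$: $\phi_{\mu\boxplus\nu}=\phi_\mu+\phi_\nu$ on a common cone. Additive monotone convolution $\rhd$: $F_{\mu\rhd\nu}=F_\mu\circ F_\nu$ on $\mathbb{C}^+$. Additive subordination: for $\mu,\sigma\in\mathcal{P}(\mathbb{R})$, $\mathbb{A}_\sigma(\mu)$ is the unique probability measure on $\mathbb{R}$ with $\sigma\boxplus\mu=\sigma\rhd\mathbb{A}_\sigma(\mu)$; it is characterized by $\phi_{\mathbb{A}_\sigma(\mu)}(z)=\phi_\mu(F_\sigma(z))$ on some cone $\Gamma_{\lambda,M}$.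 *)

theory Defs
  imports "HOL-Probability.Probability"
begin

definition real_prob :: "real measure \<Rightarrow> bool" where
  "real_prob \<mu> \<longleftrightarrow> prob_space \<mu> \<and> sets \<mu> = sets borel"

definition cauchy_G :: "real measure \<Rightarrow> complex \<Rightarrow> complex" where
  "cauchy_G \<mu> z = (LINT x|\<mu>. 1 / (z - complex_of_real x))"

definition cauchy_F :: "real measure \<Rightarrow> complex \<Rightarrow> complex" where
  "cauchy_F \<mu> z = 1 / cauchy_G \<mu> z"

definition tcone :: "real \<Rightarrow> real \<Rightarrow> complex set" where
  "tcone l M = {z. Im z > 0 \<and> \<bar>Re z\<bar> < l * Im z \<and> Im z > M}"

definition voiculescu_on :: "real measure \<Rightarrow> (complex \<Rightarrow> complex) \<Rightarrow> complex set \<Rightarrow> bool" where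
  "voiculescu_on \<mu> \<phi> Gam \<longleftrightarrow>
     (\<exists>l' M'. l' > 0 \<and> M' > 0 \<and> inj_on (cauchy_F \<mu>) (tcone l' M') \<and>
        Gam \<subseteq> cauchy_F \<mu> ` tcone l' M' \<and>
        (\<forall>z\<in>Gam. \<phi> z = inv_into (tcone l' M') (cauchy_F \<mu>) z - z))"

definition free_conv :: "real measure \<Rightarrow> real measure \<Rightarrow> real measure" where
  "free_conv \<mu> \<nu> = (THE \<rho>. real_prob \<rho> \<and>
     (\<exists>l M \<phi>\<mu> \<phi>\<nu> \<phi>\<rho>. l > 0 \<and> M > 0 \<and>
        voiculescu_on \<mu> \<phi>\<mu> (tcone l M) \<and> voiculescu_on \<nu> \<phi>\<nu> (tcone l M) \<and>
        voiculescu_on \<rho> \<phi>\<rho> (tcone l M) \<and>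
        (\<forall>z\<in>tcone l M. \<phi>\<rho> z = \<phi>\<mu> z + \<phi>\<nu> z)))"

definition mono_conv :: "real measure \<Rightarrow> real measure \<Rightarrow> real measure" where
  "mono_conv \<mu> \<nu> = (THE \<rho>. real_prob \<rho> \<and>
     (\<forall>z. Im z > 0 \<longrightarrow> cauchy_F \<rho> z = cauchy_F \<mu> (cauchy_F \<nu> z)))"

definition subord :: "real measure \<Rightarrow> real measure \<Rightarrow> real measure" where
  "subord \<sigma> \<mu> = (THE \<rho>. real_prob \<rho> \<and> free_conv \<sigma> \<mu> = mono_conv \<sigma> \<rho>)"

end

theory Submission
  imports Defs "HOL-Complex_Analysis.Complex_Analysis"
begin

text \<open>
  Near infinity in a cone, \<open>F = cauchy_F \<mu>\<close> is a perturbation of the identity, so it has an inverse there and the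
  germ of the Voiculescu transform \<open>\<phi>\<close> is characterised by \<open>\<phi> (F w) = w - F w\<close>. The analytic input
  is Nevanlinna's theorem: the functions \<open>cauchy_F \<rho>\<close> are exactly the holomorphic maps \<open>f\<close> of the upper
  half-plane with \<open>Im (f z) \<ge> Im z\<close> that are asymptotic to the identity. It turns compositions of reciprocal Cauchy
  transforms into monotone convolutions, and it turns the subordination functions, found by solving
  \<open>\<omega> = z + H\<^sub>\<nu> (z + H\<^sub>\<mu> \<omega>)\<close> with \<open>H z = F z - z\<close>, into measures; so all the convolutions exist.
  Both identities then follow by comparing germs, as \<open>\<phi>\<close> of \<open>subord \<sigma> \<mu>\<close> is that of \<open>\<mu>\<close>
  composed with \<open>cauchy_F \<sigma>\<close>.
\<close>

section \<open>Cauchy transforms\<close>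

text \<open>The three operations are defined by \<open>THE\<close>, so nothing is known about their
  values before existence and uniqueness are settled; this, not the two identities, is the bulk of
  the work. Uniqueness has two layers: a germ of \<open>\<phi>\<close> determines
  \<open>cauchy_F\<close> in a cone and hence, by analytic continuation, on the half-plane; and
  \<open>cauchy_G\<close> on the half-plane determines the measure by a Fourier argument. Existence
  is harder because it is global: the subordination map contracts only in a cone, while a measure
  requires a function on the whole half-plane. The definitions quantify existentially over both the
  aperture and the height of cones, and over the cone on which \<open>cauchy_F\<close> is inverted.
  Germs are therefore compared along a filter generated by all cones. \<open>cauchy_F\<close>
  preserves this filter in both directions, so a claim about a germ at \<open>v\<close> can be
  tested at \<open>v = cauchy_F \<mu> w\<close>, and inverse functions hardly ever have to be
  handled.\<close>

lemma real_prob_iff_real_distribution: "real_prob \<mu> \<longleftrightarrow> real_distribution \<mu>"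
  by (simp add: real_prob_def real_distribution_def real_distribution_axioms_def)

lemma real_probD: "real_prob \<mu> \<Longrightarrow> real_distribution \<mu>"
  by (simp add: real_prob_iff_real_distribution)

lemma norm_resolvent_le:
  assumes "Im z > 0"
  shows "norm (1 / (z - of_real x)) \<le> 1 / Im z"
proof -
  have "Im z \<le> norm (z - of_real x)"
    using abs_Im_le_cmod[of "z - of_real x"] assms by simp
  then show ?thesis
    using assms by (simp add: norm_divide frac_le)
qed

lemma diff_of_real_nonzero: "Im z > 0 \<Longrightarrow> z - complex_of_real x \<noteq> 0"
  by (metis Im_complex_of_real eq_iff_diff_eq_0 less_irrefl)

lemma resolvent_diff:
  assumes "Im z > 0" "Im w > 0"
  shows "1 / (z - complex_of_real x) - 1 / (w - complex_of_real x)
     = (w - z) * (1 / (z - complex_of_real x) * (1 / (w - complex_of_real x)))"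
  using diff_of_real_nonzero[OF assms(1), of x] diff_of_real_nonzero[OF assms(2), of x]
  by (simp add: field_simps)

lemma norm_diff_square_complex:
  "(norm (k - g))\<^sup>2 = (norm k)\<^sup>2 - 2 * Re (cnj g * k) + (norm (g::complex))\<^sup>2"
  unfolding cmod_power2 by (simp add: power2_eq_square algebra_simps)

context real_distribution
begin

lemma prob_UNIV [simp]: "prob UNIV = 1"
  using prob_space by simp

lemma integrable_resolvent:
  assumes "Im z > 0"
  shows "integrable M (\<lambda>x. 1 / (z - complex_of_real x))"
  by (rule integrable_const_bound[where B = "1 / Im z"])
    (use norm_resolvent_le[OF assms] in auto)

lemma integrable_resolvent_prod:
  assumes "Im z > 0" "Im w > 0"
  shows "integrable M (\<lambda>x. 1 / (z - complex_of_real x) * (1 / (w - complex_of_real x)))"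
proof (rule integrable_const_bound[where B = "1 / Im z * (1 / Im w)"])
  have "norm (1 / (z - complex_of_real x) * (1 / (w - complex_of_real x))) \<le> 1 / Im z * (1 / Im w)" for x
    unfolding norm_mult using assms by (intro mult_mono norm_resolvent_le) auto
  then show "AE x in M. norm (1 / (z - complex_of_real x) * (1 / (w - complex_of_real x)))
      \<le> 1 / Im z * (1 / Im w)" by simp
qed simp

text \<open>The resolvent identity under the integral. It reduces differentiability of
  \<open>cauchy_G\<close> to continuity of the product integral, and later yields the Lipschitz
  bound for \<open>cauchy_F\<close> in a cone.\<close>

lemma cauchy_G_diff:
  assumes "Im z > 0" "Im w > 0"
  shows "cauchy_G M z - cauchy_G M w =
    (w - z) * (LINT x|M. 1 / (z - complex_of_real x) * (1 / (w - complex_of_real x)))"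
proof -
  show ?thesis
    unfolding cauchy_G_def
    using integrable_resolvent assms
    by (subst Bochner_Integration.integral_diff[symmetric])
      (simp_all add: resolvent_diff del: mult_1_right times_divide_eq_right)
qed

lemma holomorphic_cauchy_G: "cauchy_G M holomorphic_on {z. Im z > 0}"
proof (rule holomorphic_onI)
  fix w :: complex assume "w \<in> {z. Im z > 0}"
  then have w: "Im w > 0" by simp
  define Q where "Q z = (LINT x|M. 1 / (z - complex_of_real x) * (1 / (w - complex_of_real x)))" for z
  have "((\<lambda>z. Q w - Q z) \<longlongrightarrow> 0) (at w)"
  proof (rule Lim_null_comparison)
    \<comment> \<open>Staying above half the height of \<open>w\<close> bounds the resolvent at
      \<open>z\<close> uniformly by \<open>2 / Im w\<close>.\<close>
    have "eventually (\<lambda>z. Im z > Im w / 2) (at w)"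
      using w by (intro order_tendstoD(1)[where a="Im w / 2"]) (auto intro!: tendsto_intros)
    then show "eventually (\<lambda>z. norm (Q w - Q z) \<le> norm (z - w) * (1 / Im w * (2 / Im w) * (1 / Im w))) (at w)"
    proof eventually_elim
      case (elim z)
      then have z: "Im z > 0" using w by simp
      have eq: "1 / (w - complex_of_real x) * (1 / (w - complex_of_real x)) - 1 / (z - complex_of_real x) * (1 / (w - complex_of_real x))
         = (z - w) * (1 / (w - complex_of_real x) * (1 / (z - complex_of_real x)) * (1 / (w - complex_of_real x)))" for x
        using arg_cong[OF resolvent_diff[OF w z, of x], of "\<lambda>t. t * (1 / (w - complex_of_real x))"]
        by (simp only: algebra_simps)
      have le: "norm ((z - w) * (1 / (w - complex_of_real x) * (1 / (z - complex_of_real x)) * (1 / (w - complex_of_real x))))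
         \<le> norm (z - w) * (1 / Im w * (2 / Im w) * (1 / Im w))" for x
      proof -
        have "norm (1 / (z - complex_of_real x)) \<le> 2 / Im w"
          using norm_resolvent_le[OF z, of x] elim w z
          by (elim order_trans) (auto simp: field_simps)
        then show ?thesis
          unfolding norm_mult using norm_resolvent_le[OF w, of x] w
          by (intro mult_left_mono mult_mono) auto
      qed
      have "Q w - Q z = (LINT x|M. (z - w) * (1 / (w - complex_of_real x) * (1 / (z - complex_of_real x)) * (1 / (w - complex_of_real x))))"
        unfolding Q_def eq[symmetric]
        by (intro Bochner_Integration.integral_diff[symmetric] integrable_resolvent_prod z w)
      moreover have "norm \<dots> \<le> (LINT x|M. norm (z - w) * (1 / Im w * (2 / Im w) * (1 / Im w)))"
        by (intro Bochner_Integration.integral_norm_bound_integral integrable_const_bound[where B="norm (z - w) * (1 / Im w * (2 / Im w) * (1 / Im w))"])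
          (use le w in \<open>auto simp: abs_mult simp del: times_divide_eq_right mult_1_right\<close>)
      ultimately show ?case by simp
    qed
    show "((\<lambda>z. norm (z - w) * (1 / Im w * (2 / Im w) * (1 / Im w))) \<longlongrightarrow> 0) (at w)"
      by (rule tendsto_eq_intros refl | simp)+
  qed
  then have "((\<lambda>z. - (Q w - (Q w - Q z))) \<longlongrightarrow> - (Q w - 0)) (at w)"
    by (intro tendsto_intros)
  then have "((\<lambda>z. - Q z) \<longlongrightarrow> - Q w) (at w)" by simp
  moreover have "eventually (\<lambda>z. - Q z = (cauchy_G M z - cauchy_G M w) / (z - w)) (at w)"
  proof -
    have "eventually (\<lambda>z. Im z > 0) (at w)"
      using w by (intro order_tendstoD(1)[where a="0"]) (auto intro!: tendsto_intros)
    moreover have "eventually (\<lambda>z. z \<noteq> w) (at w)" by (rule eventually_neq_at_within)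
    ultimately show ?thesis
    proof eventually_elim
      case (elim z)
      then show ?case unfolding Q_def cauchy_G_diff[OF elim(1) w]
        by (simp add: field_simps)
    qed
  qed
  ultimately have "((\<lambda>z. (cauchy_G M z - cauchy_G M w) / (z - w)) \<longlongrightarrow> - Q w) (at w)"
    by (rule Lim_transform_eventually)
  then have "(cauchy_G M has_field_derivative - Q w) (at w)"
    by (simp add: has_field_derivative_iff)
  then show "cauchy_G M field_differentiable at w within {z. 0 < Im z}"
    using field_differentiable_at_within field_differentiable_def by blast
qed

lemma integrable_norm_resolvent_sq:
  assumes "Im z > 0"
  shows "integrable M (\<lambda>x. (norm (1 / (z - complex_of_real x)))\<^sup>2)"
  using integrable_norm[OF integrable_resolvent_prod[OF assms assms]]
  by (simp add: norm_mult norm_divide power2_eq_square)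

lemma Im_cauchy_G:
  assumes "Im z > 0"
  shows "Im (cauchy_G M z) = - Im z * (LINT x|M. (norm (1 / (z - complex_of_real x)))\<^sup>2)"
proof -
  have "Im (1 / (z - complex_of_real x)) = - Im z * (norm (1 / (z - complex_of_real x)))\<^sup>2" for x
    by (simp add: Im_divide norm_divide power_divide cmod_power2)
  then show ?thesis
    unfolding cauchy_G_def using integrable_resolvent[OF assms]
    by (subst integral_Im[symmetric]) auto
qed

text \<open>The gap between the two sides is the variance of the resolvent, hence nonnegative.
  Combined with \<open>Im_cauchy_G\<close> it shows that \<open>cauchy_F\<close> does not decrease
  imaginary parts.\<close>

lemma norm_cauchy_G_sq_le:
  assumes "Im z > 0"
  shows "(norm (cauchy_G M z))\<^sup>2 \<le> (LINT x|M. (norm (1 / (z - complex_of_real x)))\<^sup>2)"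
proof -
  let ?G = "cauchy_G M z" and ?k = "\<lambda>x. 1 / (z - complex_of_real x)"
  have int: "integrable M (\<lambda>x. cnj ?G * ?k x)"
    by (intro integrable_mult_right integrable_resolvent assms)
  have int': "integrable M (\<lambda>x. Re (cnj ?G * ?k x))"
    by (rule integrable_Re[OF int])
  have eq: "(LINT x|M. Re (cnj ?G * ?k x)) = Re (cnj ?G * ?G)"
    unfolding integral_Re[OF int] by (simp add: cauchy_G_def del: mult_1_right times_divide_eq_right)
  have "0 \<le> (LINT x|M. (norm (?k x - ?G))\<^sup>2)"
    by (rule Bochner_Integration.integral_nonneg) simp
  also have "\<dots> = (LINT x|M. (norm (?k x))\<^sup>2) - 2 * Re (cnj ?G * ?G) + (norm ?G)\<^sup>2"
    unfolding norm_diff_square_complex using integrable_norm_resolvent_sq[OF assms] int int'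
    by (simp add: eq del: complex_cnj_divide Re_complex_div_eq_0 times_divide_eq_right mult_1_right Complex.times_complex.sel)
  also have "Re (cnj ?G * ?G) = (norm ?G)\<^sup>2"
    unfolding cmod_power2 by (simp add: power2_eq_square)
  finally show ?thesis by simp
qed

lemma Im_cauchy_G_neg:
  assumes "Im z > 0"
  shows "Im (cauchy_G M z) < 0"
proof -
  let ?f = "\<lambda>x. (norm (1 / (z - complex_of_real x)))\<^sup>2"
  have "(LINT x|M. ?f x) \<noteq> 0"
  proof
    assume "(LINT x|M. ?f x) = 0"
    then have "AE x in M. ?f x = 0"
      by (subst (asm) integral_nonneg_eq_0_iff_AE) (use integrable_norm_resolvent_sq[OF assms] in auto)
    then have "AE x in M. False"
      using diff_of_real_nonzero[OF assms] by (auto elim!: eventually_mono)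
    then show False by (simp add: AE_False)
  qed
  moreover have "0 \<le> (LINT x|M. ?f x)" by (rule Bochner_Integration.integral_nonneg) simp
  ultimately show ?thesis unfolding Im_cauchy_G[OF assms] using assms by (simp add: less_le)
qed

lemma cauchy_G_nonzero: "Im z > 0 \<Longrightarrow> cauchy_G M z \<noteq> 0"
  using Im_cauchy_G_neg by fastforce

lemma Im_cauchy_F_ge:
  assumes "Im z > 0"
  shows "Im (cauchy_F M z) \<ge> Im z"
proof -
  have pos: "(norm (cauchy_G M z))\<^sup>2 > 0" using cauchy_G_nonzero[OF assms] by simp
  have "Im (cauchy_F M z) = - Im (cauchy_G M z) / (norm (cauchy_G M z))\<^sup>2"
    by (simp add: cauchy_F_def Im_divide cmod_power2)
  also have "\<dots> \<ge> Im z"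
    using Im_cauchy_G[OF assms] norm_cauchy_G_sq_le[OF assms] assms pos
    by (simp add: pos_le_divide_eq mult_left_mono)
  finally show ?thesis .
qed

lemma Im_cauchy_F_pos: "Im z > 0 \<Longrightarrow> Im (cauchy_F M z) > 0"
  using Im_cauchy_F_ge by fastforce

lemma holomorphic_cauchy_F: "cauchy_F M holomorphic_on {z. Im z > 0}"
  unfolding cauchy_F_def[abs_def] using cauchy_G_nonzero
  by (intro holomorphic_intros holomorphic_cauchy_G) auto

end

section \<open>Injectivity of the Cauchy transform\<close>

lemma integrable_inverse_1_plus_square_lborel: "integrable lborel (\<lambda>s::real. 1 / (1 + s\<^sup>2))"
  using integrable_inverse_1_plus_square
  by (simp add: set_integrable_def einterval_def inverse_eq_divide)

lemma integral_inverse_1_plus_square_lborel: "(LBINT s. 1 / (1 + s\<^sup>2)) = pi"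
  using LBINT_inverse_1_plus_square
  by (simp add: interval_lebesgue_integral_def set_lebesgue_integral_def einterval_def inverse_eq_divide)

text \<open>The Fourier transform of the Cauchy kernel, classically
  \<open>pi * exp (- \<bar>v\<bar>)\<close>; what enters below is its limit \<open>pi\<close> at
  0.\<close>

definition poisson_char :: "real \<Rightarrow> complex" where
  "poisson_char v = (LBINT s. iexp (v * s) * of_real (1 / (1 + s\<^sup>2)))"

lemma poisson_char_tendsto: "X \<longlonglongrightarrow> 0 \<Longrightarrow> (\<lambda>n. poisson_char (X n)) \<longlonglongrightarrow> of_real pi"
proof -
  assume X: "X \<longlonglongrightarrow> 0"
  have "(\<lambda>n. poisson_char (X n)) \<longlonglongrightarrow> (LBINT s. complex_of_real (1 / (1 + s\<^sup>2)))"
    unfolding poisson_char_def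
  proof (rule integral_dominated_convergence)
    show "integrable lborel (\<lambda>s::real. 1 / (1 + s\<^sup>2))" by (rule integrable_inverse_1_plus_square_lborel)
    have "(\<lambda>n. iexp (X n * s) * complex_of_real (1 / (1 + s\<^sup>2)))
        \<longlonglongrightarrow> iexp (0 * s) * complex_of_real (1 / (1 + s\<^sup>2))" for s
      by (intro tendsto_intros X)
    then show "AE s in lborel. (\<lambda>n. iexp (X n * s) * complex_of_real (1 / (1 + s\<^sup>2)))
        \<longlonglongrightarrow> complex_of_real (1 / (1 + s\<^sup>2))" by simp
    show "AE s in lborel. norm (iexp (X n * s) * complex_of_real (1 / (1 + s\<^sup>2))) \<le> 1 / (1 + s\<^sup>2)" for n
      by (simp add: norm_mult norm_divide del: of_real_divide)
  qed auto
  then show ?thesis by (simp only: integral_complex_of_real integral_inverse_1_plus_square_lborel)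
qed

context real_distribution
begin

lemma Im_cauchy_G_poisson:
  assumes "y > 0"
  shows "- Im (cauchy_G M (Complex x y)) = (LINT t|M. y / ((x - t)\<^sup>2 + y\<^sup>2))"
proof -
  have eq: "- Im (1 / (Complex x y - complex_of_real t)) = y / ((x - t)\<^sup>2 + y\<^sup>2)" for t
    by (simp add: Im_divide)
  show ?thesis
    unfolding cauchy_G_def eq[symmetric] using integrable_resolvent[of "Complex x y"] assms
    by (subst integral_Im[symmetric]) auto
qed

text \<open>On the line at height \<open>y\<close>, \<open>- Im G\<close> is the convolution of the
  measure with the Poisson kernel, so its Fourier transform factorises.\<close>

lemma fourier_Im_cauchy_G:
  assumes y: "y > 0"
  shows "(LBINT x. iexp (u * x) * complex_of_real (- Im (cauchy_G M (Complex x y))))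
    = char M u * poisson_char (u * y)"
proof -
  define f where "f = (\<lambda>(t, x). iexp (u * x) * complex_of_real (y / ((x - t)\<^sup>2 + y\<^sup>2)))"
  have [measurable]: "f \<in> borel_measurable (M \<Otimes>\<^sub>M lborel)"
    unfolding f_def by measurable
  interpret P: pair_sigma_finite M lborel
    by (simp add: pair_sigma_finite_def sigma_finite_measure_axioms lborel.sigma_finite_measure_axioms)
  have affine: "y / ((t + y * s - t)\<^sup>2 + y\<^sup>2) = (1 / (1 + s\<^sup>2)) / y" for s t
  proof -
    have "(t + y * s - t)\<^sup>2 + y\<^sup>2 = y * (y * (1 + s\<^sup>2))"
      by (simp add: power2_eq_square algebra_simps)
    then show ?thesis using y by simp
  qed
  have int_norm: "integrable lborel (\<lambda>x. y / ((x - t)\<^sup>2 + y\<^sup>2))" for t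
    by (rule lborel_integrable_real_affine_iff[THEN iffD1, of y _ t])
      (use y integrable_divide[OF integrable_inverse_1_plus_square_lborel, of y] affine in simp_all)
  have norm_f: "norm (f (t, x)) = y / ((x - t)\<^sup>2 + y\<^sup>2)" for t x
    using y by (simp add: f_def norm_mult del: of_real_divide)
  \<comment> \<open>The substitution \<open>x = t + y * s\<close> turns each kernel into the
    standard one, so this integral is the same for all \<open>t\<close>; that makes Fubini
    applicable.\<close>
  have norm_int: "(LBINT x. norm (f (t, x))) = pi" for t
  proof -
    have "(LBINT x. y / ((x - t)\<^sup>2 + y\<^sup>2)) = y *\<^sub>R (LBINT s. y / ((t + y * s - t)\<^sup>2 + y\<^sup>2))"
      using y by (subst lborel_integral_real_affine[of y _ t]) auto
    then show ?thesis
      using y unfolding norm_f affine by (simp only: integral_divide_zero integral_inverse_1_plus_square_lborel) simp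
  qed
  have f_int: "integrable (M \<Otimes>\<^sub>M lborel) f"
  proof (rule P.Fubini_integrable)
    show "integrable M (\<lambda>t. LBINT x. norm (f (t, x)))" unfolding norm_int by simp
    have "integrable lborel (\<lambda>x. f (t, x))" for t
    proof (rule Bochner_Integration.integrable_bound[OF int_norm[of t]])
      show "AE x in lborel. norm (f (t, x)) \<le> norm (y / ((x - t)\<^sup>2 + y\<^sup>2))"
        by (intro AE_I2) (simp only: norm_f real_norm_def abs_ge_self)
    qed (simp add: f_def)
    then show "AE t in M. integrable lborel (\<lambda>x. f (t, x))" by simp
  qed simp
  have inner: "(LBINT x. f (t, x)) = iexp (u * t) * poisson_char (u * y)" for t
  proof -
    have "(LBINT x. f (t, x)) = y *\<^sub>R (LBINT s. f (t, t + y * s))"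
      using y by (subst lborel_integral_real_affine[of y _ t]) auto
    also have "\<dots> = (LBINT s. y *\<^sub>R f (t, t + y * s))" by simp
    also have "\<dots> = (LBINT s. iexp (u * t) * (iexp (u * y * s) * of_real (1 / (1 + s\<^sup>2))))"
    proof (intro Bochner_Integration.integral_cong refl)
      fix s
      have "iexp (u * (t + y * s)) = iexp (u * t) * iexp (u * y * s)"
        by (simp add: exp_add[symmetric] algebra_simps)
      then show "y *\<^sub>R f (t, t + y * s) = iexp (u * t) * (iexp (u * y * s) * of_real (1 / (1 + s\<^sup>2)))"
        using y unfolding f_def prod.case affine by (simp add: scaleR_conv_of_real)
    qed
    also have "\<dots> = iexp (u * t) * poisson_char (u * y)"
      unfolding poisson_char_def by (rule integral_mult_right_zero)
    finally show ?thesis .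
  qed
  have "(LBINT x. iexp (u * x) * complex_of_real (- Im (cauchy_G M (Complex x y))))
      = (LBINT x. (LINT t|M. f (t, x)))"
    unfolding Im_cauchy_G_poisson[OF y] f_def prod.case
    by (simp only: integral_mult_right_zero integral_complex_of_real)
  also have "\<dots> = (LINT t|M. (LBINT x. f (t, x)))"
    using P.Fubini_integral[of "\<lambda>t x. f (t, x)"] f_int by (simp add: case_prod_eta)
  also have "\<dots> = char M u * poisson_char (u * y)"
    unfolding inner char_def by (rule integral_mult_left_zero)
  finally show ?thesis .
qed

end

text \<open>As the height \<open>1 / Suc n\<close> tends to 0, the Poisson factor tends to the
  nonzero number \<open>pi\<close>, so the characteristic function can be recovered from
  \<open>cauchy_G\<close>.\<close>

theorem cauchy_G_inject:
  assumes "real_distribution \<mu>" "real_distribution \<nu>"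
    and eq: "\<And>z. Im z > 0 \<Longrightarrow> cauchy_G \<mu> z = cauchy_G \<nu> z"
  shows "\<mu> = \<nu>"
proof (rule Levy_uniqueness)
  show "char \<mu> = char \<nu>"
  proof
    fix u
    have lim: "(\<lambda>n. char \<rho> u * poisson_char (u * (1 / Suc n))) \<longlonglongrightarrow> char \<rho> u * of_real pi" for \<rho>
    proof (intro tendsto_intros poisson_char_tendsto)
      show "(\<lambda>n. u * (1 / Suc n)) \<longlonglongrightarrow> 0"
        using tendsto_mult[OF tendsto_const LIMSEQ_inverse_real_of_nat, of u] by (simp add: inverse_eq_divide)
    qed
    have "char \<mu> u * poisson_char (u * (1 / Suc n)) = char \<nu> u * poisson_char (u * (1 / Suc n))" for n
    proof -
      have y: "1 / real (Suc n) > 0" by simp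
      show ?thesis
        unfolding real_distribution.fourier_Im_cauchy_G[OF assms(1) y, symmetric]
          real_distribution.fourier_Im_cauchy_G[OF assms(2) y, symmetric]
        using y eq by simp
    qed
    then have "char \<mu> u * of_real pi = char \<nu> u * of_real pi"
      using LIMSEQ_unique[OF lim[of \<mu>]] lim[of \<nu>] by (simp only: )
    then show "char \<mu> u = char \<nu> u" by simp
  qed
qed fact+

lemma cauchy_F_inject:
  assumes "real_distribution \<mu>" "real_distribution \<nu>"
    and "\<And>z. Im z > 0 \<Longrightarrow> cauchy_F \<mu> z = cauchy_F \<nu> z"
  shows "\<mu> = \<nu>"
  using cauchy_G_inject[OF assms(1,2)] assms(3) by (simp add: cauchy_F_def)

section \<open>Voiculescu transforms as germs at infinity\<close>

lemma tcone_mono: "l \<le> l' \<Longrightarrow> N' \<le> N \<Longrightarrow> tcone l N \<subseteq> tcone l' N'"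
  unfolding tcone_def by (auto intro: order_less_le_trans[OF _ mult_right_mono])

lemma tcone_Im_pos: "z \<in> tcone l N \<Longrightarrow> Im z > 0"
  by (simp add: tcone_def)

lemma tcone_imp_norm_le: "z \<in> tcone l N \<Longrightarrow> norm z \<le> (1 + l) * Im z"
  using cmod_le[of z] by (auto simp: tcone_def algebra_simps)

text \<open>A relative error of at most 1/2 costs half the height, and one of at most
  \<open>l / 4\<close> added to the aperture \<open>l / 4\<close> gives
  \<open>\<bar>Re z\<bar> < l / 2 * Im w \<le> l * Im z\<close>. Hence the margins 4 and 2.\<close>

lemma tcone_perturb:
  assumes w: "w \<in> tcone (l / 4) (2 * N)" and d: "d \<le> 1 / 2" "d \<le> l / 4"
    and z: "norm (z - w) \<le> d * Im w"
  shows "z \<in> tcone l N"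
proof -
  have w': "Im w > 0" "\<bar>Re w\<bar> < l / 4 * Im w" "Im w > 2 * N" using w by (auto simp: tcone_def)
  have im: "\<bar>Im z - Im w\<bar> \<le> d * Im w" and re: "\<bar>Re z - Re w\<bar> \<le> d * Im w"
    using abs_Im_le_cmod[of "z - w"] abs_Re_le_cmod[of "z - w"] z by auto
  have "d * Im w \<le> 1 / 2 * Im w" "d * Im w \<le> l / 4 * Im w"
    using d w'(1) by (intro mult_right_mono; simp)+
  then have im': "Im z \<ge> Im w / 2" and re': "\<bar>Re z\<bar> < l / 2 * Im w"
    using im re w' by linarith+
  have "l > 0" using w' by (smt (verit) mult_nonpos_nonneg divide_le_0_iff)
  then have "l / 2 * Im w \<le> l * Im z" using im' mult_left_mono[of "Im w / 2" "Im z" l] by simp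
  then show ?thesis using im' re' w' by (auto simp: tcone_def)
qed

text \<open>Turns "on some truncated cone" into \<open>eventually\<close>. The cones become thinner
  as well as higher, because no aperture is distinguished in the definitions of the
  transforms.\<close>

definition high_cone :: "complex filter" where
  "high_cone = (INF (l, N) \<in> {0<..} \<times> {0<..}. principal (tcone l N))"

lemma eventually_high_cone:
  "eventually P high_cone \<longleftrightarrow> (\<exists>l>0. \<exists>N>0. \<forall>z\<in>tcone l N. P z)"
proof -
  have "eventually P high_cone \<longleftrightarrow>
     (\<exists>b\<in>{0<..} \<times> {0<..}. eventually P (case b of (l, N) \<Rightarrow> principal (tcone l N)))"
    unfolding high_cone_def
  proof (rule eventually_INF_base)
    have "(1, 1) \<in> {0::real<..} \<times> {0::real<..}" by simp
    then show "{0::real<..} \<times> {0::real<..} \<noteq> {}" by blast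
  next
    fix a b :: "real \<times> real"
    assume *: "a \<in> {0<..} \<times> {0<..}" "b \<in> {0<..} \<times> {0<..}"
    define c where "c = (min (fst a) (fst b), max (snd a) (snd b))"
    have "tcone (fst c) (snd c) \<subseteq> tcone (fst a) (snd a)" "tcone (fst c) (snd c) \<subseteq> tcone (fst b) (snd b)"
      unfolding c_def by (rule tcone_mono; simp)+
    moreover have "c \<in> {0<..} \<times> {0<..}" using * by (auto simp: c_def less_max_iff_disj)
    ultimately show "\<exists>x\<in>{0<..} \<times> {0<..}. (case x of (l, N) \<Rightarrow> principal (tcone l N))
        \<le> inf (case a of (l, N) \<Rightarrow> principal (tcone l N)) (case b of (l, N) \<Rightarrow> principal (tcone l N))"
      by (intro bexI[of _ c]) (simp_all add: case_prod_unfold)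
  qed
  then show ?thesis by (simp add: eventually_principal Bex_def conj_assoc)
qed

lemma eventually_in_tcone: "l > 0 \<Longrightarrow> eventually (\<lambda>z. z \<in> tcone l N) high_cone"
  unfolding eventually_high_cone using tcone_mono[of l l N "max N 1"]
  by (intro exI[of _ l] conjI exI[of _ "max N 1"]) auto

lemma eventually_high_cone_Im_pos: "eventually (\<lambda>z. Im z > 0) high_cone"
  using eventually_in_tcone[of 1 1] by (auto elim!: eventually_mono simp: tcone_def)

lemma high_cone_imaginary_axis: "filterlim (\<lambda>y. Complex 0 y) high_cone at_top"
  unfolding filterlim_iff eventually_high_cone
proof safe
  fix P and l N :: real assume *: "l > 0" "N > 0" "\<forall>z\<in>tcone l N. P z"
  show "\<forall>\<^sub>F x in at_top. P (Complex 0 x)"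
    using eventually_gt_at_top[of N] by eventually_elim (use * in \<open>auto simp: tcone_def\<close>)
qed

text \<open>Expresses \<open>f z = z + o(z)\<close>; in a cone \<open>Im z\<close> and
  \<open>norm z\<close> are comparable. The cone may depend on \<open>d\<close>, even in its
  aperture.\<close>

definition asymp_id :: "(complex \<Rightarrow> complex) \<Rightarrow> bool" where
  "asymp_id f \<longleftrightarrow> (\<forall>d>0. eventually (\<lambda>z. norm (f z - z) \<le> d * Im z) high_cone)"

lemma asymp_id_filterlim:
  assumes "asymp_id f"
  shows "filterlim f high_cone high_cone"
  unfolding filterlim_iff eventually_high_cone[of P for P]
proof safe
  fix P and l N :: real assume *: "l > 0" "N > 0" "\<forall>z\<in>tcone l N. P z"
  have "eventually (\<lambda>z. norm (f z - z) \<le> min (1 / 2) (l / 4) * Im z) high_cone"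
    using assms * unfolding asymp_id_def by auto
  moreover have "eventually (\<lambda>z. z \<in> tcone (l / 4) (2 * N)) high_cone"
    using * by (intro eventually_in_tcone) auto
  ultimately have "eventually (\<lambda>z. P (f z)) high_cone"
    by eventually_elim (use * tcone_perturb[of _ l N "min (1 / 2) (l / 4)"] in auto)
  then show "\<exists>l>0. \<exists>N>0. \<forall>z\<in>tcone l N. P (f z)" by (simp add: eventually_high_cone)
qed

lemma asymp_id_compose:
  assumes "asymp_id f" "asymp_id g"
  shows "asymp_id (\<lambda>z. f (g z))"
  unfolding asymp_id_def
proof safe
  fix d :: real assume d: "d > 0"
  \<comment> \<open>With \<open>e \<le> 1\<close> the inner map at most doubles the imaginary part,
    so the outer error is at most \<open>2 * e * Im z\<close> and the total at most
    \<open>3 * e * Im z\<close>.\<close>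
  define e where "e = min 1 (d / 3)"
  have e: "e > 0" "e \<le> 1" "e * 3 \<le> d" using d by (auto simp: e_def)
  have "eventually (\<lambda>z. norm (f z - z) \<le> e * Im z) high_cone"
    using assms(1) e unfolding asymp_id_def by auto
  then have "eventually (\<lambda>z. norm (f (g z) - g z) \<le> e * Im (g z)) high_cone"
    by (rule eventually_compose_filterlim[OF _ asymp_id_filterlim[OF assms(2)]])
  moreover have "eventually (\<lambda>z. norm (g z - z) \<le> e * Im z) high_cone"
    using assms(2) e unfolding asymp_id_def by auto
  ultimately show "eventually (\<lambda>z. norm (f (g z) - z) \<le> d * Im z) high_cone"
    using eventually_high_cone_Im_pos
  proof eventually_elim
    case (elim z)
    have "e * Im z \<le> 1 * Im z" using e elim by (intro mult_right_mono) auto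
    then have "Im (g z) \<le> 2 * Im z" using elim(2) abs_Im_le_cmod[of "g z - z"] by auto
    then have "e * Im (g z) \<le> e * (2 * Im z)" using e by (intro mult_left_mono) auto
    moreover have "norm (f (g z) - z) \<le> norm (f (g z) - g z) + norm (g z - z)"
      using norm_triangle_ineq[of "f (g z) - g z" "g z - z"] by simp
    moreover have "(e * 3) * Im z \<le> d * Im z" using e elim by (intro mult_right_mono) auto
    ultimately show ?case using elim by linarith
  qed
qed

text \<open>Surjectivity near infinity: solving \<open>f z = w\<close> amounts to a fixed point of
  \<open>z \<mapsto> w - (f z - z)\<close>, which Brouwer provides in a disc around \<open>w\<close>.\<close>

lemma tcone_subset_image:
  assumes l0: "l0 > 0" and f: "\<And>d. d > 0 \<Longrightarrow> \<exists>N>0. \<forall>z\<in>tcone l0 N. norm (f z - z) \<le> d * Im z"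
    and cont: "continuous_on {z. Im z > 0} f" and l: "l > 0" "N > 0"
  shows "\<exists>l'>0. \<exists>N'>0. tcone l' N' \<subseteq> f ` tcone l N"
proof -
  \<comment> \<open>The error \<open>d\<close> is chosen in terms of \<open>l1 \<le> l0\<close>.
    This would be circular if the aperture \<open>l0\<close> in the hypothesis depended on
    \<open>d\<close>, as it may in \<open>asymp_id\<close>.\<close>
  define l1 d where "l1 = min l l0" and "d = min (1 / 2) (l1 / 4)"
  have l1: "l1 > 0" and d: "d > 0" "d \<le> 1 / 2" "d \<le> l1 / 4" using l l0 by (auto simp: l1_def d_def)
  \<comment> \<open>Half of \<open>d\<close>, since points of the disc around \<open>w\<close> have
    imaginary part up to \<open>2 * Im w\<close>; the map then sends the disc of radius
    \<open>d * Im w\<close> into itself.\<close>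
  obtain N1 where N1: "N1 > 0" and close: "\<And>z. z \<in> tcone l0 N1 \<Longrightarrow> norm (f z - z) \<le> d / 2 * Im z"
    using f[of "d / 2"] d by auto
  define N2 where "N2 = max N N1"
  have sub: "tcone l1 N2 \<subseteq> tcone l N" "tcone l1 N2 \<subseteq> tcone l0 N1"
    by (rule tcone_mono; simp add: l1_def N2_def)+
  have "w \<in> f ` tcone l N" if w: "w \<in> tcone (l1 / 4) (2 * N2)" for w
  proof -
    have Imw: "Im w > 0" using w by (rule tcone_Im_pos)
    have cone: "z \<in> tcone l1 N2" if "z \<in> cball w (d * Im w)" for z
      using tcone_perturb[OF w d(2,3), of z] that by (simp add: dist_norm norm_minus_commute)
    have "\<exists>z\<in>cball w (d * Im w). w - (f z - z) = z"
    proof (rule brouwer)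
      show "continuous_on (cball w (d * Im w)) (\<lambda>z. w - (f z - z))"
        using cone by (intro continuous_intros continuous_on_subset[OF cont]) (auto simp: tcone_def)
      show "(\<lambda>z. w - (f z - z)) \<in> cball w (d * Im w) \<rightarrow> cball w (d * Im w)"
      proof (rule Pi_I)
        fix z assume z: "z \<in> cball w (d * Im w)"
        have "Im z - Im w \<le> d * Im w"
          using abs_Im_le_cmod[of "z - w"] z by (simp add: dist_norm norm_minus_commute)
        moreover have "d * Im w \<le> 1 * Im w" using d Imw by (intro mult_right_mono) auto
        ultimately have "d / 2 * Im z \<le> d / 2 * (2 * Im w)" using d by (intro mult_left_mono) auto
        then show "w - (f z - z) \<in> cball w (d * Im w)"
          using close[of z] cone[OF z] sub by (auto simp: dist_norm)
      qed
      have "0 \<le> d * Im w" using d Imw by simp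
      then show "cball w (d * Im w) \<noteq> {}" unfolding cball_eq_empty by (rule leD)
    qed (blast | simp)+
    then obtain z where "z \<in> cball w (d * Im w)" "w - (f z - z) = z" by blast
    then show ?thesis using cone[of z] sub by (intro image_eqI[of _ _ z]) (auto simp: algebra_simps)
  qed
  then show ?thesis using l1 N1 l by (intro exI[of _ "l1 / 4"] conjI exI[of _ "2 * N2"]) (auto simp: N2_def)
qed

section \<open>The reciprocal Cauchy transform in a cone\<close>

context real_distribution
begin

text \<open>Since the measure may lack a first moment, \<open>\<bar>x\<bar> / N\<close> is capped.
  The cap \<open>2 + l\<close> is the bound of \<open>\<bar>x\<bar> / norm (u - x)\<close> for
  \<open>u\<close> in a cone of aperture \<open>l\<close>.\<close>

lemma tendsto_integral_min_abs:
  "((\<lambda>N. LINT x|M. min (\<bar>x\<bar> / N) (2 + l)) \<longlongrightarrow> 0) at_top" if "l > 0" for l :: real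
proof -
  have "((\<lambda>N. LINT x|M. min (\<bar>x\<bar> / N) (2 + l)) \<longlongrightarrow> (LINT x|M. 0)) at_top"
  proof (rule integral_dominated_convergence_at_top[where w = "\<lambda>_. 2 + l"])
    show "\<forall>\<^sub>F N in at_top. AE x in M. norm (min (\<bar>x\<bar> / N) (2 + l)) \<le> 2 + l"
      using eventually_gt_at_top[of 0] by eventually_elim (use that in \<open>auto simp: min_def\<close>)
    have "((\<lambda>N. min (\<bar>x\<bar> / N) (2 + l)) \<longlongrightarrow> min 0 (2 + l)) at_top" for x
      by (intro tendsto_min tendsto_divide_0[OF tendsto_const] tendsto_const filterlim_at_top_imp_at_infinity filterlim_ident)
    then show "AE x in M. ((\<lambda>N. min (\<bar>x\<bar> / N) (2 + l)) \<longlongrightarrow> 0) at_top" using that by simp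
  qed auto
  then show ?thesis by simp
qed

text \<open>One has \<open>u * G u = 1 + A u\<close>, where \<open>A u\<close> is the integral of
  \<open>x / (u - x)\<close> and is uniformly small high up in the cone; hence
  \<open>F u = u / (1 + A u)\<close>. The first bound gives the asymptotics, the second, a Lipschitz
  bound for \<open>F - id\<close>, gives injectivity and the contraction used for
  subordination.\<close>

lemma cauchy_F_cone_estimate:
  assumes l: "l > 0" and d: "d > 0"
  obtains N where "N > 0" "\<And>u. u \<in> tcone l N \<Longrightarrow> norm (cauchy_F M u - u) \<le> d * Im u"
    "\<And>u v. u \<in> tcone l N \<Longrightarrow> v \<in> tcone l N \<Longrightarrow>
      norm ((cauchy_F M u - u) - (cauchy_F M v - v)) \<le> d * norm (u - v)"
proof -
  \<comment> \<open>\<open>e \<le> 1 / 2\<close> keeps \<open>norm (1 + A u)\<close> above 1/2;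
    \<open>4 * (3 + l) * e\<close> is the Lipschitz constant reached at the end and also dominates
    the constant \<open>2 * (1 + l) * e\<close> of the first estimate.\<close>
  define e where "e = min (1 / 2) (d / (4 * (3 + l)))"
  have e1: "4 * (3 + l) * e \<le> d"
  proof -
    have "4 * (3 + l) * e \<le> 4 * (3 + l) * (d / (4 * (3 + l)))"
      using l unfolding e_def by (intro mult_left_mono min.cobounded2) auto
    also have "\<dots> = d" using l by simp
    finally show ?thesis .
  qed
  have "d / (4 * (3 + l)) > 0" using l d by simp
  then have e: "e > 0" "e \<le> 1 / 2" "4 * (3 + l) * e \<le> d"
    using e1 unfolding e_def by linarith+
  have "\<forall>\<^sub>F N in at_top. (LINT x|M. min (\<bar>x\<bar> / N) (2 + l)) < e"
    by (rule order_tendstoD(2)[OF tendsto_integral_min_abs[OF l] e(1)])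
  then have "\<forall>\<^sub>F N in at_top. (LINT x|M. min (\<bar>x\<bar> / N) (2 + l)) < e \<and> N > 0"
    using eventually_gt_at_top[of 0] by (rule eventually_conj)
  from eventually_happens'[OF _ this]
  obtain N :: real where N: "N > 0" and small: "(LINT x|M. min (\<bar>x\<bar> / N) (2 + l)) < e"
    by auto
  define a where "a u x = complex_of_real x / (u - complex_of_real x)" for u x
  define A where "A u = (LINT x|M. a u x)" for u
  have int_min: "integrable M (\<lambda>x. min (\<bar>x\<bar> / N) (2 + l))"
    by (rule integrable_const_bound[where B = "2 + l"]) (use N l in \<open>auto simp: min_def\<close>)
  have a_meas [measurable]: "a u \<in> borel_measurable M" for u
    unfolding a_def by measurable
  have a_le: "norm (a u x) \<le> min (\<bar>x\<bar> / N) (2 + l)" if u: "u \<in> tcone l N" for u x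
  proof -
    have Im: "Im u > 0" "Im u > N" using u by (auto simp: tcone_def)
    have ge: "Im u \<le> norm (u - complex_of_real x)"
      using abs_Im_le_cmod[of "u - complex_of_real x"] Im by simp
    have "\<bar>x\<bar> / norm (u - complex_of_real x) \<le> \<bar>x\<bar> / N"
      using ge Im N by (intro divide_left_mono mult_pos_pos) linarith+
    moreover have "\<bar>x\<bar> \<le> norm (u - complex_of_real x) + norm u"
      using norm_triangle_ineq4[of u "u - complex_of_real x"] by simp
    then have "\<bar>x\<bar> \<le> norm (u - complex_of_real x) + (1 + l) * norm (u - complex_of_real x)"
      using tcone_imp_norm_le[OF u] mult_left_mono[OF ge, of "1 + l"] l by linarith
    then have "\<bar>x\<bar> / norm (u - complex_of_real x) \<le> 2 + l"
      using ge Im by (subst pos_divide_le_eq) (auto simp: algebra_simps)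
    ultimately show ?thesis by (simp add: a_def norm_divide)
  qed
  have a_int: "integrable M (a u)" if "u \<in> tcone l N" for u
    by (rule Bochner_Integration.integrable_bound[OF int_min]) (use order_trans[OF a_le[OF that] abs_ge_self] in auto)
  have A_le: "norm (A u) \<le> e" if "u \<in> tcone l N" for u
    unfolding A_def
    using Bochner_Integration.integral_norm_bound_integral[OF a_int[OF that] int_min] a_le[OF that] small by force
  have A_nz: "1 + A u \<noteq> 0" and A_ge: "norm (1 + A u) \<ge> 1 / 2" if "u \<in> tcone l N" for u
  proof -
    show *: "norm (1 + A u) \<ge> 1 / 2"
      using A_le[OF that] e norm_diff_ineq[of 1 "A u"] by simp
    show "1 + A u \<noteq> 0" using * by auto
  qed
  have one_plus: "u * (1 / (u - complex_of_real x)) = 1 + a u x" if "Im u > 0" for u x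
    using diff_of_real_nonzero[OF that, of x] by (simp add: a_def field_simps)
  have G: "cauchy_G M u = (1 + A u) / u" if u: "u \<in> tcone l N" for u
  proof -
    have Im: "Im u > 0" using u by (rule tcone_Im_pos)
    have "u * cauchy_G M u = (LINT x|M. 1 + a u x)"
      unfolding cauchy_G_def integral_mult_right_zero[symmetric] one_plus[OF Im] ..
    also have "\<dots> = 1 + A u" using a_int[OF u] by (simp add: A_def)
    finally show ?thesis using Im by (intro eq_divide_imp) (auto simp: mult.commute)
  qed
  have F: "cauchy_F M u = u / (1 + A u)" if "u \<in> tcone l N" for u
    unfolding cauchy_F_def G[OF that] by simp
  have 1: "norm (cauchy_F M u - u) \<le> d * Im u" if u: "u \<in> tcone l N" for u
  proof -
    have "cauchy_F M u - u = - (u * A u) / (1 + A u)"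
      unfolding F[OF u] using A_nz[OF u] by (simp add: field_simps)
    then have "norm (cauchy_F M u - u) = norm u * norm (A u) / norm (1 + A u)"
      by (simp add: norm_mult norm_divide)
    also have "\<dots> \<le> ((1 + l) * Im u) * e / (1 / 2)"
      using tcone_imp_norm_le[OF u] A_le[OF u] A_ge[OF u] e l tcone_Im_pos[OF u]
      by (intro frac_le mult_mono) auto
    also have "\<dots> = (2 * (1 + l) * e) * Im u" by simp
    also have "\<dots> \<le> (4 * (3 + l) * e) * Im u"
      using e l tcone_Im_pos[OF u] by (intro mult_right_mono) auto
    also have "\<dots> \<le> d * Im u"
      using e(3) tcone_Im_pos[OF u] by (intro mult_right_mono) auto
    finally show ?thesis .
  qed
  have 2: "norm ((cauchy_F M u - u) - (cauchy_F M v - v)) \<le> d * norm (u - v)"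
    if u: "u \<in> tcone l N" and v: "v \<in> tcone l N" for u v
  proof -
    have Im: "Im u > 0" "Im v > 0" using u v by (auto intro: tcone_Im_pos)
    define Q where "Q = (LINT x|M. 1 / (u - complex_of_real x) * (1 / (v - complex_of_real x)))"
    define B where "B = (LINT x|M. a u x * a v x)"
    have ab: "norm (a u x * a v x) \<le> (2 + l) * min (\<bar>x\<bar> / N) (2 + l)" for x
      unfolding norm_mult using a_le[OF u, of x] a_le[OF v, of x] l by (intro mult_mono) auto
    have int_ab: "integrable M (\<lambda>x. a u x * a v x)"
    proof (rule Bochner_Integration.integrable_bound)
      show "integrable M (\<lambda>x. (2 + l) * min (\<bar>x\<bar> / N) (2 + l))" using int_min by simp
      show "AE x in M. norm (a u x * a v x) \<le> norm ((2 + l) * min (\<bar>x\<bar> / N) (2 + l))"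
        using ab order_trans[OF ab abs_ge_self] by auto
    qed simp
    have "norm B \<le> (LINT x|M. (2 + l) * min (\<bar>x\<bar> / N) (2 + l))"
      unfolding B_def using int_ab int_min ab by (intro Bochner_Integration.integral_norm_bound_integral) auto
    also have "\<dots> \<le> (2 + l) * e" using small l by simp
    finally have B: "norm B \<le> (2 + l) * e" .
    have "u * v * (1 / (u - complex_of_real x) * (1 / (v - complex_of_real x)))
        = 1 + a u x + a v x + a u x * a v x" for x
    proof -
      have "u * v * (1 / (u - complex_of_real x) * (1 / (v - complex_of_real x)))
          = (u * (1 / (u - complex_of_real x))) * (v * (1 / (v - complex_of_real x)))"
        by (simp only: ac_simps)
      then show ?thesis unfolding one_plus[OF Im(1)] one_plus[OF Im(2)] by (simp add: algebra_simps)
    qed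
    then have "u * v * Q = (LINT x|M. 1 + a u x + a v x + a u x * a v x)"
      unfolding Q_def integral_mult_right_zero[symmetric] by simp
    also have "\<dots> = 1 + A u + A v + B"
      using a_int[OF u] a_int[OF v] int_ab by (simp add: A_def B_def)
    finally have Q: "u * v * Q = 1 + A u + A v + B" .
    have nz: "u \<noteq> 0" "v \<noteq> 0" using Im by auto
    have "cauchy_F M u - cauchy_F M v = (cauchy_G M v - cauchy_G M u) / (cauchy_G M u * cauchy_G M v)"
      unfolding cauchy_F_def using cauchy_G_nonzero[OF Im(1)] cauchy_G_nonzero[OF Im(2)] by (simp add: field_simps)
    also have "cauchy_G M v - cauchy_G M u = (u - v) * Q"
      using cauchy_G_diff[OF Im] unfolding Q_def[symmetric] by (simp add: algebra_simps)
    also have "(u - v) * Q / (cauchy_G M u * cauchy_G M v) = (u - v) * (u * v * Q) / ((1 + A u) * (1 + A v))"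
      unfolding G[OF u] G[OF v] using nz by (simp add: field_simps)
    finally have "(cauchy_F M u - u) - (cauchy_F M v - v)
        = (u - v) * (1 + A u + A v + B) / ((1 + A u) * (1 + A v)) - (u - v)"
      unfolding Q by (simp add: algebra_simps)
    \<comment> \<open>Subtracting \<open>(1 + A u) * (1 + A v)\<close> from the numerator cancels
      the terms linear in \<open>A\<close>, leaving only products of the small quantities
      \<open>a\<close>.\<close>
    also have "\<dots> = (u - v) * (B - A u * A v) / ((1 + A u) * (1 + A v))"
      using A_nz[OF u] A_nz[OF v] by (simp add: divide_simps) (simp add: algebra_simps)
    finally have "norm ((cauchy_F M u - u) - (cauchy_F M v - v))
        = norm (u - v) * norm (B - A u * A v) / (norm (1 + A u) * norm (1 + A v))"
      by (simp add: norm_mult norm_divide)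
    also have "\<dots> \<le> norm (u - v) * ((2 + l) * e + e) / (1 / 2 * (1 / 2))"
    proof (intro frac_le mult_left_mono mult_mono)
      have "norm (A u * A v) \<le> e * 1"
        unfolding norm_mult using A_le[OF u] A_le[OF v] e by (intro mult_mono) auto
      then show "norm (B - A u * A v) \<le> (2 + l) * e + e"
        using norm_triangle_ineq4[of B "A u * A v"] B by simp
    qed (use A_ge[OF u] A_ge[OF v] e l in auto)
    also have "\<dots> = (4 * (3 + l) * e) * norm (u - v)" by (simp add: algebra_simps)
    also have "\<dots> \<le> d * norm (u - v)" using e(3) by (intro mult_right_mono) auto
    finally show ?thesis .
  qed
  show ?thesis by (rule that[OF N 1 2])
qed

lemma cauchy_F_near_id:
  assumes "l > 0" "d > 0"
  shows "\<exists>N>0. \<forall>z\<in>tcone l N. norm (cauchy_F M z - z) \<le> d * Im z"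
proof (rule cauchy_F_cone_estimate[OF assms])
  fix N :: real
  assume *: "N > 0" "\<And>u. u \<in> tcone l N \<Longrightarrow> norm (cauchy_F M u - u) \<le> d * Im u"
  then show ?thesis by (intro exI[of _ N] conjI ballI)
qed

lemma asymp_id_cauchy_F: "asymp_id (cauchy_F M)"
  unfolding asymp_id_def eventually_high_cone
  by (intro allI impI exI[of _ 1] conjI zero_less_one cauchy_F_near_id)

lemma filterlim_cauchy_F: "filterlim (cauchy_F M) high_cone high_cone"
  by (rule asymp_id_filterlim[OF asymp_id_cauchy_F])

lemma inj_on_cauchy_F: "\<exists>N>0. inj_on (cauchy_F M) (tcone 1 N)"
proof (rule cauchy_F_cone_estimate[OF zero_less_one])
  show "(1 :: real) / 2 > 0" by simp
next
  fix N :: real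
  assume N: "N > 0" and le: "\<And>u v. u \<in> tcone 1 N \<Longrightarrow> v \<in> tcone 1 N \<Longrightarrow>
      norm ((cauchy_F M u - u) - (cauchy_F M v - v)) \<le> 1 / 2 * norm (u - v)"
  have "inj_on (cauchy_F M) (tcone 1 N)"
  proof (rule inj_onI)
    fix u v assume "u \<in> tcone 1 N" "v \<in> tcone 1 N" "cauchy_F M u = cauchy_F M v"
    then show "u = v" using le[of u v] by (simp add: norm_minus_commute)
  qed
  with N show "\<exists>N>0. inj_on (cauchy_F M) (tcone 1 N)" by blast
qed

lemma tcone_subset_cauchy_F_image:
  "l > 0 \<Longrightarrow> N > 0 \<Longrightarrow> \<exists>l'>0. \<exists>N'>0. tcone l' N' \<subseteq> cauchy_F M ` tcone l N"
  by (rule tcone_subset_image[OF zero_less_one cauchy_F_near_id[OF zero_less_one]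
    holomorphic_on_imp_continuous_on[OF holomorphic_cauchy_F]])

text \<open>One direction is convergence along the filter; the other holds because the image of any
  cone contains a cone. This permits the substitution \<open>v = cauchy_F M w\<close>, after which
  Voiculescu transforms are explicit.\<close>

lemma eventually_cauchy_F_iff:
  "eventually (\<lambda>z. P (cauchy_F M z)) high_cone \<longleftrightarrow> eventually P high_cone"
proof
  assume "eventually (\<lambda>z. P (cauchy_F M z)) high_cone"
  then obtain l N where "l > 0" "N > 0" "\<forall>z\<in>tcone l N. P (cauchy_F M z)"
    by (auto simp: eventually_high_cone)
  moreover from this tcone_subset_cauchy_F_image obtain l' N'
    where "l' > 0" "N' > 0" "tcone l' N' \<subseteq> cauchy_F M ` tcone l N" by blast
  ultimately show "eventually P high_cone" unfolding eventually_high_cone by blast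
qed (rule eventually_compose_filterlim[OF _ filterlim_cauchy_F])

lemma exists_voiculescu_on: "\<exists>\<phi>. \<exists>l>0. \<exists>N>0. voiculescu_on M \<phi> (tcone l N)"
proof -
  obtain N where N: "N > 0" "inj_on (cauchy_F M) (tcone 1 N)" using inj_on_cauchy_F by blast
  moreover obtain l' N' where "l' > 0" "N' > 0" "tcone l' N' \<subseteq> cauchy_F M ` tcone 1 N"
    using tcone_subset_cauchy_F_image[of 1 N] N by auto
  ultimately have "voiculescu_on M (\<lambda>z. inv_into (tcone 1 N) (cauchy_F M) z - z) (tcone l' N')"
    unfolding voiculescu_on_def by (intro exI[of _ 1] exI[of _ N]) auto
  then show ?thesis using \<open>l' > 0\<close> \<open>N' > 0\<close> by blast
qed

lemma voiculescu_on_cauchy_F: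
  assumes "voiculescu_on M \<phi> (tcone l N)" "l > 0"
  shows "eventually (\<lambda>w. \<phi> (cauchy_F M w) = w - cauchy_F M w) high_cone"
proof -
  obtain l' N' where *: "l' > 0" "N' > 0" "inj_on (cauchy_F M) (tcone l' N')"
      "\<forall>z\<in>tcone l N. \<phi> z = inv_into (tcone l' N') (cauchy_F M) z - z"
    using assms by (auto simp: voiculescu_on_def)
  have "eventually (\<lambda>w. w \<in> tcone l' N') high_cone" by (rule eventually_in_tcone) fact
  moreover have "eventually (\<lambda>w. cauchy_F M w \<in> tcone l N) high_cone"
    unfolding eventually_cauchy_F_iff[of "\<lambda>w. w \<in> tcone l N"] by (rule eventually_in_tcone) fact
  ultimately show ?thesis by eventually_elim (use * in auto)
qed

end

lemma voiculescu_on_subset: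
  assumes "voiculescu_on \<mu> \<phi> S" "T \<subseteq> S"
  shows "voiculescu_on \<mu> \<phi> T"
proof -
  obtain l N where "l > 0" "N > 0" "inj_on (cauchy_F \<mu>) (tcone l N)" "S \<subseteq> cauchy_F \<mu> ` tcone l N"
      "\<forall>z\<in>S. \<phi> z = inv_into (tcone l N) (cauchy_F \<mu>) z - z"
    using assms(1) by (auto simp: voiculescu_on_def)
  then show ?thesis
    unfolding voiculescu_on_def using assms(2) by (intro exI[of _ l] exI[of _ N]) auto
qed

text \<open>Voiculescu transforms only matter as germs along \<open>high_cone\<close>, so a representative is fixed
  once and for all.\<close>

definition voiculescu :: "real measure \<Rightarrow> complex \<Rightarrow> complex" where
  "voiculescu \<mu> = (SOME \<phi>. \<exists>l>0. \<exists>N>0. voiculescu_on \<mu> \<phi> (tcone l N))"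

context real_distribution
begin

lemma voiculescu_on_voiculescu: "\<exists>l>0. \<exists>N>0. voiculescu_on M (voiculescu M) (tcone l N)"
  unfolding voiculescu_def using exists_voiculescu_on by (rule someI_ex)

lemma voiculescu_cauchy_F:
  "eventually (\<lambda>w. voiculescu M (cauchy_F M w) = w - cauchy_F M w) high_cone"
proof -
  obtain l N where "l > 0" "voiculescu_on M (voiculescu M) (tcone l N)"
    using voiculescu_on_voiculescu by auto
  then show ?thesis by (intro voiculescu_on_cauchy_F)
qed

text \<open>Witnesses of \<open>voiculescu_on\<close> may invert \<open>cauchy_F\<close> on
  different cones, but all inverses return \<open>w\<close> at \<open>cauchy_F M w\<close> once
  \<open>w\<close> lies in both cones.\<close>

lemma voiculescu_on_eq_voiculescu:
  assumes "voiculescu_on M \<phi> (tcone l N)" "l > 0"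
  shows "eventually (\<lambda>v. \<phi> v = voiculescu M v) high_cone"
  unfolding eventually_cauchy_F_iff[of "\<lambda>v. \<phi> v = voiculescu M v", symmetric]
  using voiculescu_on_cauchy_F[OF assms] voiculescu_cauchy_F by eventually_elim simp

end

section \<open>The Herglotz and Nevanlinna representations\<close>

text \<open>The parameter runs over \<open>{0..1}\<close>, so
  \<open>d\<zeta> / (2 * pi * \<i>)\<close> becomes \<open>\<zeta> dt\<close>, the numerator of the
  kernel.\<close>

lemma cauchy_formula_unit_circle:
  assumes f: "f holomorphic_on cball 0 1" and w: "norm w < 1"
  shows "((\<lambda>t. f (cis (2 * pi * t)) * (cis (2 * pi * t) / (cis (2 * pi * t) - w))) has_integral f w) {0..1}"
proof -
  let ?g = "circlepath 0 1"
  have cp: "?g t = cis (2 * pi * t)" for t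
    by (simp add: circlepath cis_conv_exp mult_ac)
  have "((\<lambda>u. f u / (u - w)) has_contour_integral (2 * of_real pi * \<i> * f w)) ?g"
    by (rule Cauchy_integral_circlepath_simple) (use f w in auto)
  then have "((\<lambda>t. f (?g t) / (?g t - w) * vector_derivative ?g (at t within {0..1}))
      has_integral (2 * of_real pi * \<i> * f w)) {0..1}"
    by (simp add: has_contour_integral_def)
  from has_integral_divide[OF this, of "2 * of_real pi * \<i>"]
  have "((\<lambda>t. f (?g t) / (?g t - w) * vector_derivative ?g (at t within {0..1}) / (2 * of_real pi * \<i>))
      has_integral f w) {0..1}" by simp
  then show ?thesis
  proof (rule has_integral_eq[rotated])
    fix t :: real assume t: "t \<in> {0..1}"
    then show "f (?g t) / (?g t - w) * vector_derivative ?g (at t within {0..1}) / (2 * of_real pi * \<i>)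
      = f (cis (2 * pi * t)) * (cis (2 * pi * t) / (cis (2 * pi * t) - w))"
      by (simp add: vector_derivative_circlepath01 cp) (simp add: cis_conv_exp mult_ac)
  qed
qed

lemma cis_minus_nonzero: "norm w < 1 \<Longrightarrow> cis t - w \<noteq> 0"
  by (metis eq_iff_diff_eq_0 less_irrefl norm_cis)

text \<open>Cauchy's formula is added to its conjugate for the reflected point, whose kernel
  \<open>1 / (1 - cnj w * \<zeta>)\<close> is holomorphic in the disc.\<close>

lemma schwarz_formula_unit_circle:
  assumes f: "f holomorphic_on cball 0 1" "f 0 = 1" and w: "norm w < 1"
  shows "((\<lambda>t. of_real (Re (f (cis (2 * pi * t)))) * ((cis (2 * pi * t) + w) / (cis (2 * pi * t) - w)))
    has_integral f w) {0..1}"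
proof -
  have *: "((\<lambda>t. of_real (2 * Re (f (cis (2 * pi * t)))) * (cis (2 * pi * t) / (cis (2 * pi * t) - w)))
    has_integral f w + 1) {0..1}" if w: "norm w < 1" for w
  proof -
    have nz: "1 - cnj w * \<zeta> \<noteq> 0" if "norm \<zeta> \<le> 1" for \<zeta>
    proof
      assume "1 - cnj w * \<zeta> = 0"
      then have "norm (cnj w * \<zeta>) = 1" by simp
      moreover have "norm (cnj w * \<zeta>) \<le> norm w * 1"
        unfolding norm_mult complex_mod_cnj using that by (intro mult_left_mono) auto
      ultimately show False using w by simp
    qed
    have "(\<lambda>\<zeta>. f \<zeta> / (1 - cnj w * \<zeta>)) holomorphic_on cball 0 1"
      using nz by (intro holomorphic_intros f) auto
    from cauchy_formula_unit_circle[OF this, of 0]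
    have "((\<lambda>t. f (cis (2 * pi * t)) / (1 - cnj w * cis (2 * pi * t))) has_integral 1) {0..1}"
      using f by simp
    then have "((\<lambda>t. cnj (f (cis (2 * pi * t)) / (1 - cnj w * cis (2 * pi * t)))) has_integral cnj 1) {0..1}"
      by (simp only: has_integral_cnj[unfolded o_def])
    from has_integral_add[OF cauchy_formula_unit_circle[OF f(1) w] this]
    show ?thesis unfolding complex_cnj_one
    proof (rule has_integral_eq[rotated])
      fix t :: real
      let ?e = "cis (2 * pi * t)"
      have "cnj ?e * ?e = 1" by (simp add: cis_cnj cis_mult)
      then have "?e * (1 - w * cnj ?e) = ?e - w" by (simp add: algebra_simps)
      then have "1 / (1 - w * cnj ?e) = ?e / (?e - w)"
        using cis_minus_nonzero[OF w, of "2 * pi * t"]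
        by (metis cis_neq_zero mult.right_neutral mult_divide_mult_cancel_left)
      then have "cnj (f ?e / (1 - cnj w * ?e)) = cnj (f ?e) * (?e / (?e - w))"
        by (simp add: divide_inverse)
      then show "f ?e * (?e / (?e - w)) + cnj (f ?e / (1 - cnj w * ?e)) =
          of_real (2 * Re (f ?e)) * (?e / (?e - w))"
        by (simp only: complex_add_cnj[symmetric] distrib_right)
    qed
  qed
  \<comment> \<open>The case \<open>w = 0\<close>. Subtracting half of it removes the extra 1 and
    turns the kernel \<open>2 * \<zeta> / (\<zeta> - w)\<close> into \<open>2 * \<zeta> / (\<zeta> -
    w) - 1 = (\<zeta> + w) / (\<zeta> - w)\<close>.\<close>
  have "((\<lambda>t. complex_of_real (2 * Re (f (cis (2 * pi * t))))) has_integral 2) {0..1}"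
    using *[of 0] f(2) by simp
  from has_integral_diff[OF *[OF w] has_integral_divide[OF this, of 2]]
  have "((\<lambda>t. of_real (2 * Re (f (cis (2 * pi * t)))) * (cis (2 * pi * t) / (cis (2 * pi * t) - w))
     - of_real (2 * Re (f (cis (2 * pi * t)))) / 2) has_integral f w) {0..1}" by simp
  then show ?thesis
  proof (rule has_integral_eq[rotated])
    fix t :: real
    show "of_real (2 * Re (f (cis (2 * pi * t)))) * (cis (2 * pi * t) / (cis (2 * pi * t) - w))
       - of_real (2 * Re (f (cis (2 * pi * t)))) / 2
       = of_real (Re (f (cis (2 * pi * t)))) * ((cis (2 * pi * t) + w) / (cis (2 * pi * t) - w))"
      using cis_minus_nonzero[OF w, of "2 * pi * t"] by (simp add: divide_simps) (simp add: algebra_simps)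
  qed
qed

lemma continuous_on_herglotz_kernel:
  "norm w < 1 \<Longrightarrow> continuous_on S (\<lambda>t. (cis (2 * pi * t) + w) / (cis (2 * pi * t) - w))"
  using cis_minus_nonzero[of w] by (intro continuous_intros) auto

lemma norm_herglotz_kernel_le:
  assumes "norm w < 1"
  shows "norm ((cis t + w) / (cis t - w)) \<le> 2 / (1 - norm w)"
  unfolding norm_divide
  using norm_triangle_ineq[of "cis t" w] norm_triangle_ineq2[of "cis t" w] assms
  by (intro frac_le) auto

text \<open>The Schwarz formula makes \<open>Re f\<close> on the circle the density. The circle is
  parametrised by \<open>{0..1}\<close> so that the measure lives on the real line, where weak
  compactness is available; \<open>{-1<..1}\<close> has the half-open form used in the definition of
  tightness.\<close>

lemma herglotz_cball:
  assumes f: "f holomorphic_on cball 0 1" "f 0 = 1" and Re_f: "\<And>w. norm w \<le> 1 \<Longrightarrow> Re (f w) \<ge> 0"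
  shows "\<exists>M. real_distribution M \<and> measure M {-1<..1} = 1 \<and>
    (\<forall>w. norm w < 1 \<longrightarrow> f w = (LINT t|M. (cis (2 * pi * t) + w) / (cis (2 * pi * t) - w)))"
proof -
  define g where "g t = indicator {0..1} t * Re (f (cis (2 * pi * t)))" for t :: real
  have cont: "continuous_on {0..1} (\<lambda>t. f (cis (2 * pi * t)))"
    by (intro continuous_on_compose2[OF holomorphic_on_imp_continuous_on[OF f(1)]] continuous_intros) auto
  have g_eq: "g = (\<lambda>t. indicator {0..1} t *\<^sub>R Re (f (cis (2 * pi * t))))" by (simp add: g_def fun_eq_iff)
  have g_int: "integrable lborel g"
    unfolding g_eq set_integrable_def[symmetric]
    by (intro borel_integrable_atLeastAtMost' continuous_intros cont)
  have [measurable]: "g \<in> borel_measurable borel" using borel_measurable_integrable[OF g_int] by simp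
  have g_nonneg: "g t \<ge> 0" for t using Re_f by (simp add: g_def indicator_def)
  define M where "M = density lborel (\<lambda>t. ennreal (g t))"
  have integral_M: "(LINT t|M. \<phi> t) = F"
    if [measurable]: "\<phi> \<in> borel_measurable borel" and cont_\<phi>: "continuous_on {0..1} \<phi>"
      and F: "((\<lambda>t. of_real (Re (f (cis (2 * pi * t)))) * \<phi> t) has_integral F) {0..1}" for \<phi> :: "real \<Rightarrow> complex" and F
  proof -
    have "(LINT t|M. \<phi> t) = (LINT t|lborel. g t *\<^sub>R \<phi> t)"
      unfolding M_def using g_nonneg by (intro integral_density) auto
    also have "\<dots> = (LINT t:{0..1}|lborel. of_real (Re (f (cis (2 * pi * t)))) * \<phi> t)"
      by (simp add: set_lebesgue_integral_def g_def scaleR_conv_of_real mult.assoc)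
    also have "\<dots> = integral {0..1} (\<lambda>t. of_real (Re (f (cis (2 * pi * t)))) * \<phi> t)"
      by (intro set_borel_integral_eq_integral borel_integrable_atLeastAtMost' continuous_intros cont cont_\<phi>)
    also have "\<dots> = F" using F by (rule integral_unique)
    finally show ?thesis .
  qed
  have formula: "f w = (LINT t|M. (cis (2 * pi * t) + w) / (cis (2 * pi * t) - w))" if w: "norm w < 1" for w
  proof (rule integral_M[symmetric])
    show "continuous_on {0..1} (\<lambda>t. (cis (2 * pi * t) + w) / (cis (2 * pi * t) - w))"
      by (rule continuous_on_herglotz_kernel[OF w])
    show "(\<lambda>t. (cis (2 * pi * t) + w) / (cis (2 * pi * t) - w)) \<in> borel_measurable borel"
      by (intro borel_measurable_continuous_onI continuous_on_herglotz_kernel w)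
  qed (rule schwarz_formula_unit_circle[OF f w])
  have "(LINT t|M. (1::complex)) = 1"
    using formula[of 0] f(2) by simp
  have "(LINT t|lborel. complex_of_real (g t)) = 1"
  proof -
    have "(LINT t|M. (1::complex)) = (LINT t|lborel. g t *\<^sub>R (1::complex))"
      unfolding M_def using g_nonneg by (intro integral_density) auto
    then show ?thesis using \<open>(LINT t|M. (1::complex)) = 1\<close> by (simp add: scaleR_conv_of_real)
  qed
  then have g1: "(LINT t|lborel. g t) = 1" by (simp only: integral_complex_of_real of_real_eq_1_iff)
  have "(\<integral>\<^sup>+t. ennreal (g t) \<partial>lborel) = 1"
    using nn_integral_eq_integral[OF g_int] g_nonneg g1 by simp
  then have "emeasure M (space M) = 1"
    by (simp add: M_def emeasure_density)
  then interpret prob_space M by (rule prob_spaceI)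
  have "real_distribution M"
    by unfold_locales (simp_all add: M_def)
  moreover have "measure M {-1<..1} = 1"
  proof -
    have "emeasure M {-1<..1} = (\<integral>\<^sup>+t. ennreal (g t) * indicator {-1<..1} t \<partial>lborel)"
      unfolding M_def by (intro emeasure_density) auto
    also have "\<dots> = (\<integral>\<^sup>+t. ennreal (g t) \<partial>lborel)"
      by (intro nn_integral_cong) (auto simp: g_def indicator_def)
    also have "\<dots> = 1" by fact
    finally show ?thesis by (simp add: measure_def)
  qed
  ultimately show ?thesis using formula by blast
qed

text \<open>The dilations of \<open>h\<close> extend to the closed disc. Their measures have a
  common bounded support, so some subsequence converges weakly, and the kernel is bounded and
  continuous in \<open>t\<close>, which carries the formula to the limit.\<close>

theorem herglotz_representation:
  assumes h: "h holomorphic_on ball 0 1" "h 0 = 1" and Re_h: "\<And>w. norm w < 1 \<Longrightarrow> Re (h w) \<ge> 0"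
  shows "\<exists>M. real_distribution M \<and>
    (\<forall>w. norm w < 1 \<longrightarrow> h w = (LINT t|M. (cis (2 * pi * t) + w) / (cis (2 * pi * t) - w)))"
proof -
  \<comment> \<open>The shift by 2 makes already \<open>r 0 = 1 / 2\<close> positive.\<close>
  define r where "r n = 1 - 1 / real (n + 2)" for n
  have r: "0 < r n" "r n < 1" for n by (auto simp: r_def field_simps)
  have r_norm: "norm (of_real (r n) * w) < 1" if "norm w \<le> 1" for n and w :: complex
  proof -
    have "norm (of_real (r n) * w) \<le> r n * 1"
      unfolding norm_mult using r[of n] that by (intro mult_mono) auto
    then show ?thesis using r[of n] by simp
  qed
  define P where "P n M \<longleftrightarrow> real_distribution M \<and> measure M {-1<..1} = 1 \<and> (\<forall>w. norm w < 1 \<longrightarrow>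
    h (of_real (r n) * w) = (LINT t|M. (cis (2 * pi * t) + w) / (cis (2 * pi * t) - w)))" for n M
  have "\<exists>M. P n M" for n
    unfolding P_def
  proof (rule herglotz_cball)
    show "(\<lambda>w. h (of_real (r n) * w)) holomorphic_on cball 0 1"
      using r_norm by (intro holomorphic_on_compose_gen[OF _ h(1), unfolded o_def] holomorphic_intros) auto
    show "0 \<le> Re (h (of_real (r n) * w))" if "norm w \<le> 1" for w
      by (rule Re_h[OF r_norm[OF that]])
  qed (use h in simp)
  then obtain M where PM: "\<And>n. P n (M n)" by metis
  then have M: "real_distribution (M n)" "measure (M n) {-1<..1} = 1" for n
    unfolding P_def by blast+
  have hM: "h (of_real (r n) * w) = (LINT t|M n. (cis (2 * pi * t) + w) / (cis (2 * pi * t) - w))"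
    if "norm w < 1" for n w
    using PM[of n] that unfolding P_def by blast
  have "tight M"
    unfolding tight_def
  proof (intro conjI allI impI M(1))
    fix e :: real assume "e > 0"
    then show "\<exists>a b. a < b \<and> (\<forall>n. 1 - e < measure (M n) {a<..b})"
      by (intro exI[of _ "-1"] exI[of _ 1]) (simp add: M(2))
  qed
  from tight_imp_convergent_subsubsequence[OF this strict_mono_id]
  obtain s N where s: "strict_mono s" and N: "real_distribution N" and conv: "weak_conv_m (M \<circ> id \<circ> s) N"
    by blast
  have "h w = (LINT t|N. (cis (2 * pi * t) + w) / (cis (2 * pi * t) - w))" if w: "norm w < 1" for w
  proof (rule LIMSEQ_unique)
    interpret N: real_distribution N by fact
    have "(\<lambda>n. LINT t|(M \<circ> id \<circ> s) n. (cis (2 * pi * t) + w) / (cis (2 * pi * t) - w))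
        \<longlonglongrightarrow> (LINT t|N. (cis (2 * pi * t) + w) / (cis (2 * pi * t) - w))"
    proof (rule weak_conv_imp_integral_bdd_continuous_conv[OF _ N conv])
      show "isCont (\<lambda>t. (cis (2 * pi * t) + w) / (cis (2 * pi * t) - w)) t" for t
        using continuous_on_herglotz_kernel[OF w, of UNIV] continuous_on_eq_continuous_at[OF open_UNIV]
        by blast
    qed (use M norm_herglotz_kernel_le[OF w] in auto)
    then show "(\<lambda>n. h (of_real (r (s n)) * w))
        \<longlonglongrightarrow> (LINT t|N. (cis (2 * pi * t) + w) / (cis (2 * pi * t) - w))"
      by (simp add: hM[OF w])
    have "(\<lambda>n. inverse (real (Suc (Suc n)))) \<longlonglongrightarrow> 0"
      using LIMSEQ_Suc[OF LIMSEQ_inverse_real_of_nat] .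
    then have "r \<longlonglongrightarrow> 1 - 0"
      unfolding r_def by (intro tendsto_intros) (simp add: inverse_eq_divide)
    then have "(\<lambda>n. of_real (r (s n)) * w) \<longlonglongrightarrow> of_real 1 * w"
      using LIMSEQ_subseq_LIMSEQ[OF _ s] by (intro tendsto_intros) (auto simp: o_def)
    moreover have "isCont h w"
      using holomorphic_on_imp_continuous_on[OF h(1)] w
      unfolding continuous_on_eq_continuous_at[OF open_ball] by simp
    ultimately show "(\<lambda>n. h (of_real (r (s n)) * w)) \<longlonglongrightarrow> h w"
      using isCont_tendsto_compose[of w h] by simp
  qed
  with N show ?thesis by blast
qed

text \<open>The Cayley transform sends \<open>cis \<theta>\<close> to the real point \<open>- sin \<theta> / (1 - cos \<theta>)\<close>; at
  \<open>cos \<theta> = 1\<close>, which corresponds to infinity, this expression has the junk value \<open>0\<close>.\<close>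

definition cayley_pt :: "real \<Rightarrow> real" where
  "cayley_pt \<theta> = - sin \<theta> / (1 - cos \<theta>)"

lemma one_plus_cayley_pt_sq:
  assumes "cos \<theta> \<noteq> 1"
  shows "1 + (cayley_pt \<theta>)\<^sup>2 = 2 / (1 - cos \<theta>)"
proof -
  have "(1 - cos \<theta>)\<^sup>2 + (sin \<theta>)\<^sup>2 = 2 * (1 - cos \<theta>)"
    by (simp add: sin_squared_eq) (simp add: power2_eq_square algebra_simps)
  then show ?thesis
    using assms by (simp add: cayley_pt_def power_divide add_divide_eq_iff) (simp add: divide_simps power2_eq_square)
qed

lemma cis_eq_cayley:
  assumes "cos \<theta> \<noteq> 1"
  shows "cis \<theta> * (of_real (cayley_pt \<theta>) + \<i>) = of_real (cayley_pt \<theta>) - \<i>"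
proof -
  have nz: "1 - cos \<theta> \<noteq> 0" using assms by simp
  have "cos \<theta> * cayley_pt \<theta> - sin \<theta> = cayley_pt \<theta>"
    unfolding cayley_pt_def using nz by (simp add: divide_simps) (simp add: algebra_simps)
  moreover have "sin \<theta> * cayley_pt \<theta> + cos \<theta> = - 1"
  proof -
    have *: "(1 - cos \<theta>) * cayley_pt \<theta> = - sin \<theta>" unfolding cayley_pt_def using nz by simp
    have "(1 - cos \<theta>) * (sin \<theta> * cayley_pt \<theta> + cos \<theta>)
        = sin \<theta> * ((1 - cos \<theta>) * cayley_pt \<theta>) + cos \<theta> * (1 - cos \<theta>)"
      by (simp add: algebra_simps)
    also have "\<dots> = - (sin \<theta>)\<^sup>2 + cos \<theta> * (1 - cos \<theta>)"
      unfolding * by (simp add: power2_eq_square)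
    also have "\<dots> = (1 - cos \<theta>) * (- 1)" by (simp add: sin_squared_eq) (simp add: power2_eq_square algebra_simps)
    finally show ?thesis using nz by (simp only: mult_cancel_left) simp
  qed
  ultimately show ?thesis by (simp add: complex_eq_iff)
qed

lemma norm_cayley_less_1:
  assumes "Im z > 0"
  shows "norm ((z - \<i>) / (z + \<i>)) < 1"
proof -
  have "(norm (z - \<i>))\<^sup>2 < (norm (z + \<i>))\<^sup>2"
    using assms unfolding cmod_power2 by (simp add: power2_eq_square algebra_simps)
  then have "norm (z - \<i>) < norm (z + \<i>)" by (rule power_less_imp_less_base) simp
  then show ?thesis by (simp add: norm_divide divide_less_eq)
qed

text \<open>In the real coordinate the rotated kernel is
  \<open>(x * z + 1) / (x - z) = - (1 + x^2) / (z - x) - x\<close>: a weighted resolvent plus a term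
  independent of \<open>z\<close>. The weight will become a density.\<close>

lemma herglotz_kernel_cayley:
  assumes \<theta>: "cos \<theta> \<noteq> 1" and z: "Im z > 0"
  shows "\<i> * ((cis \<theta> + (z - \<i>) / (z + \<i>)) / (cis \<theta> - (z - \<i>) / (z + \<i>)))
    = - (of_real (2 / (1 - cos \<theta>)) * (1 / (z - of_real (cayley_pt \<theta>)))) - of_real (cayley_pt \<theta>)"
proof -
  define x where "x = complex_of_real (cayley_pt \<theta>)"
  define e where "e = cis \<theta>"
  define w where "w = (z - \<i>) / (z + \<i>)"
  have zi: "z + \<i> \<noteq> 0" using z by (auto simp: complex_eq_iff)
  have xi: "x + \<i> \<noteq> 0" by (auto simp: complex_eq_iff x_def)
  have zx: "z - x \<noteq> 0" using diff_of_real_nonzero[OF z] by (simp add: x_def)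
  have e: "e * (x + \<i>) = x - \<i>" unfolding e_def x_def by (rule cis_eq_cayley) fact
  have w: "w * (z + \<i>) = z - \<i>" using zi by (simp add: w_def)
  have "(e + w) * ((x + \<i>) * (z + \<i>)) = (e * (x + \<i>)) * (z + \<i>) + (w * (z + \<i>)) * (x + \<i>)"
    by (simp add: algebra_simps)
  also have "\<dots> = 2 * (x * z + 1)" unfolding e w by (simp add: algebra_simps)
  finally have num: "(e + w) * ((x + \<i>) * (z + \<i>)) = 2 * (x * z + 1)" .
  have "(e - w) * ((x + \<i>) * (z + \<i>)) = (e * (x + \<i>)) * (z + \<i>) - (w * (z + \<i>)) * (x + \<i>)"
    by (simp add: algebra_simps)
  also have "\<dots> = 2 * \<i> * (x - z)" unfolding e w by (simp add: algebra_simps)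
  finally have den: "(e - w) * ((x + \<i>) * (z + \<i>)) = 2 * \<i> * (x - z)" .
  have "(e + w) / (e - w) = (e + w) * ((x + \<i>) * (z + \<i>)) / ((e - w) * ((x + \<i>) * (z + \<i>)))"
    using xi zi by simp
  also have "\<dots> = (x * z + 1) / (\<i> * (x - z))"
    unfolding num den mult.assoc by (simp only: mult_divide_mult_cancel_left_if) simp
  finally have "\<i> * ((e + w) / (e - w)) = (x * z + 1) / (x - z)"
    by simp
  also have "\<dots> = - ((1 + x\<^sup>2) * (1 / (z - x))) - x"
    using zx by (simp add: field_simps power2_eq_square)
  also have "1 + x\<^sup>2 = of_real (2 / (1 - cos \<theta>))"
    unfolding one_plus_cayley_pt_sq[OF \<theta>, symmetric] x_def by simp
  finally show ?thesis unfolding e_def w_def x_def .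
qed

text \<open>Multiplied by \<open>y\<close>, this increases with \<open>y\<close> to
  \<open>2 / (1 - cos \<theta>)\<close> if \<open>cos \<theta> \<noteq> 1\<close>, and equals
  \<open>y^2\<close> otherwise: the dichotomy between finite points and the point at
  infinity.\<close>

lemma Re_herglotz_kernel_cayley:
  assumes y: "y > 0"
  shows "Re ((cis \<theta> + (\<i> * of_real y - \<i>) / (\<i> * of_real y + \<i>)) / (cis \<theta> - (\<i> * of_real y - \<i>) / (\<i> * of_real y + \<i>)))
    = 2 * y / ((1 + cos \<theta>) + y\<^sup>2 * (1 - cos \<theta>))"
proof -
  let ?w = "(\<i> * of_real y - \<i>) / (\<i> * of_real y + \<i>)"
  \<comment> \<open>The Cayley image of \<open>\<i> * y\<close> is the real number
    \<open>b / a\<close>.\<close>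
  define a b where "a = y + 1" and "b = y - 1"
  have a: "a > 0" using y by (simp add: a_def)
  have "?w = (\<i> * of_real b) / (\<i> * of_real a)" by (simp add: a_def b_def algebra_simps)
  also have "\<dots> = of_real b / of_real a" by simp
  finally have w: "?w = of_real b / of_real a" .
  have "(cis \<theta> + ?w) / (cis \<theta> - ?w) = ((cis \<theta> + ?w) * of_real a) / ((cis \<theta> - ?w) * of_real a)"
    using a by simp
  also have "\<dots> = (of_real a * cis \<theta> + of_real b) / (of_real a * cis \<theta> - of_real b)"
    unfolding w using a by (simp add: algebra_simps)
  finally have eq: "(cis \<theta> + ?w) / (cis \<theta> - ?w) = (of_real a * cis \<theta> + of_real b) / (of_real a * cis \<theta> - of_real b)" .
  have num: "(a * cos \<theta> + b) * (a * cos \<theta> - b) + (a * sin \<theta>) * (a * sin \<theta>) = 2 * (2 * y)"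
  proof -
    have "(a * cos \<theta> + b) * (a * cos \<theta> - b) + (a * sin \<theta>) * (a * sin \<theta>)
        = a\<^sup>2 * ((cos \<theta>)\<^sup>2 + (sin \<theta>)\<^sup>2) - b\<^sup>2"
      by (simp only: power2_eq_square algebra_simps)
    then show ?thesis by (simp add: a_def b_def power2_eq_square algebra_simps)
  qed
  have den: "(a * cos \<theta> - b)\<^sup>2 + (a * sin \<theta>)\<^sup>2 = 2 * ((1 + cos \<theta>) + y\<^sup>2 * (1 - cos \<theta>))"
  proof -
    have "(a * cos \<theta> - b)\<^sup>2 + (a * sin \<theta>)\<^sup>2 = a\<^sup>2 * ((cos \<theta>)\<^sup>2 + (sin \<theta>)\<^sup>2) - 2 * a * b * cos \<theta> + b\<^sup>2"
      by (simp only: power2_eq_square algebra_simps)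
    then show ?thesis by (simp add: a_def b_def power2_eq_square algebra_simps)
  qed
  have "Re ((cis \<theta> + ?w) / (cis \<theta> - ?w)) = 2 * (2 * y) / (2 * ((1 + cos \<theta>) + y\<^sup>2 * (1 - cos \<theta>)))"
    unfolding eq num[symmetric] den[symmetric] by (simp add: Re_divide)
  then show ?thesis by (simp only: mult_divide_mult_cancel_left_if) simp
qed

text \<open>Carrying the Herglotz measure \<open>M\<close> to the real line gives Nevanlinna's formula. The growth
  condition on the imaginary axis says, by monotone convergence, that \<open>M\<close> has no mass at
  infinity and that \<open>2 / (1 - cos \<theta>) = 1 + (cayley_pt \<theta>)\<^sup>2\<close> is integrable, so that it
  can be absorbed into the measure.\<close>

theorem cauchy_G_representation:
  assumes K: "K holomorphic_on {z. Im z > 0}" and Im_K: "\<And>z. Im z > 0 \<Longrightarrow> Im (K z) > 0"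
    and lim: "((\<lambda>y. of_real y * K (\<i> * of_real y)) \<longlongrightarrow> \<i>) at_top"
  shows "\<exists>\<rho>. real_distribution \<rho> \<and> (\<forall>z. Im z > 0 \<longrightarrow> K z = - cauchy_G \<rho> z)"
proof -
  define a \<kappa> where "a = complex_of_real (Re (K \<i>))" and "\<kappa> = Im (K \<i>)"
  have \<kappa>: "\<kappa> > 0" using Im_K[of \<i>] by (simp add: \<kappa>_def)
  have K_i: "K \<i> - a = \<i> * of_real \<kappa>" by (simp add: complex_eq_iff a_def \<kappa>_def)
  \<comment> \<open>\<open>K\<close> in the disc coordinate, where \<open>\<i>\<close> corresponds
    to 0; subtracting \<open>a\<close> and dividing by \<open>\<i> * \<kappa>\<close> gives
    nonnegative real part and the value 1 at 0.\<close>
  define h where "h w = (K (\<i> * ((1 + w) / (1 - w))) - a) / (\<i> * of_real \<kappa>)" for w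
  have Im_inv_cayley: "Im (\<i> * ((1 + w) / (1 - w))) > 0" if w: "norm w < 1" for w
  proof -
    have "w \<noteq> 1" using w by auto
    then have d: "(norm (1 - w))\<^sup>2 > 0" by simp
    have "Im (\<i> * ((1 + w) / (1 - w))) = (1 - (norm w)\<^sup>2) / (norm (1 - w))\<^sup>2"
      unfolding cmod_power2 Im_i_times Re_divide by (simp add: power2_eq_square algebra_simps)
    moreover have "(norm w)\<^sup>2 < 1" using w by (simp add: power_less_one_iff)
    ultimately show ?thesis using d by simp
  qed
  obtain M where M: "real_distribution M" and hM: "\<And>w. norm w < 1 \<Longrightarrow>
      h w = (LINT t|M. (cis (2 * pi * t) + w) / (cis (2 * pi * t) - w))"
  proof -
    have "\<exists>M. real_distribution M \<and>
      (\<forall>w. norm w < 1 \<longrightarrow> h w = (LINT t|M. (cis (2 * pi * t) + w) / (cis (2 * pi * t) - w)))"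
    proof (rule herglotz_representation)
      have "(\<lambda>w. K (\<i> * ((1 + w) / (1 - w)))) holomorphic_on ball 0 1"
        using Im_inv_cayley
        by (intro holomorphic_on_compose_gen[OF _ K, unfolded o_def] holomorphic_intros) auto
      then show "h holomorphic_on ball 0 1"
        unfolding h_def[abs_def] using \<kappa> by (intro holomorphic_intros) auto
      show "h 0 = 1" unfolding h_def using \<kappa> K_i by simp
      show "0 \<le> Re (h w)" if "norm w < 1" for w
      proof -
        have "h w = of_real (1 / \<kappa>) * (- \<i> * (K (\<i> * ((1 + w) / (1 - w))) - a))"
          unfolding h_def using \<kappa> by (simp add: field_simps)
        then have "Re (h w) = 1 / \<kappa> * Im (K (\<i> * ((1 + w) / (1 - w))))"
          by (simp add: a_def)
        then show ?thesis using Im_K[OF Im_inv_cayley[OF that]] \<kappa> by simp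
      qed
    qed
    then show thesis using that by blast
  qed
  interpret M: real_distribution M by fact
  define ker where "ker z t = (cis (2 * pi * t) + (z - \<i>) / (z + \<i>)) / (cis (2 * pi * t) - (z - \<i>) / (z + \<i>))" for z t
  have ker_meas [measurable]: "ker z \<in> borel_measurable borel" if "Im z > 0" for z
    unfolding ker_def
    by (intro borel_measurable_continuous_onI continuous_on_herglotz_kernel norm_cayley_less_1 that)
  have ker_int: "integrable M (ker z)" if "Im z > 0" for z
    using norm_herglotz_kernel_le[OF norm_cayley_less_1[OF that]] ker_meas[OF that]
    by (intro M.integrable_const_bound[where B = "2 / (1 - norm ((z - \<i>) / (z + \<i>)))"]) (auto simp: ker_def)
  have K_eq: "K z = a + \<i> * of_real \<kappa> * (LINT t|M. ker z t)" if z: "Im z > 0" for z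
  proof -
    have zi: "z + \<i> \<noteq> 0" using z by (auto simp: complex_eq_iff)
    have "\<i> * ((1 + (z - \<i>) / (z + \<i>)) / (1 - (z - \<i>) / (z + \<i>))) = z"
    proof -
      have "1 + (z - \<i>) / (z + \<i>) = 2 * z / (z + \<i>)" "1 - (z - \<i>) / (z + \<i>) = 2 * \<i> / (z + \<i>)"
        using zi by (simp_all add: divide_simps)
      then show ?thesis using zi by simp
    qed
    then have "h ((z - \<i>) / (z + \<i>)) = (K z - a) / (\<i> * of_real \<kappa>)"
      unfolding h_def by (simp only:)
    then have "K z = a + \<i> * of_real \<kappa> * h ((z - \<i>) / (z + \<i>))" using \<kappa> by simp
    then show ?thesis unfolding hM[OF norm_cayley_less_1[OF z]] ker_def .
  qed
  define c where "c t = cos (2 * pi * t)" for t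
  define x where "x t = cayley_pt (2 * pi * t)" for t
  define p where "p t = \<kappa> * (2 / (1 - c t))" for t
  have [measurable]: "c \<in> borel_measurable borel" "x \<in> borel_measurable borel" "p \<in> borel_measurable borel"
    unfolding p_def c_def x_def cayley_pt_def by measurable
  have c_le: "c t \<le> 1" "c t \<ge> -1" for t by (simp_all add: c_def)
  \<comment> \<open>Chosen so that its integral is \<open>Im (y * K (\<i> * y))\<close> at
    \<open>y = Suc n\<close>, which the growth condition sends to 1.\<close>
  define q where "q n t = \<kappa> * (2 * (real (Suc n))\<^sup>2 / ((1 + c t) + (real (Suc n))\<^sup>2 * (1 - c t)))" for n t
  have q_eq: "q n t = real (Suc n) * \<kappa> * Re (ker (\<i> * of_real (real (Suc n))) t)" for n t
    unfolding ker_def Re_herglotz_kernel_cayley[of "real (Suc n)", OF of_nat_0_less_iff[THEN iffD2, OF zero_less_Suc]]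
    by (simp add: q_def c_def power2_eq_square)
  have q_int: "integrable M (q n)" for n
    unfolding q_eq[abs_def] by (intro integrable_mult_right integrable_Re ker_int) simp
  have q_lim: "(\<lambda>n. integral\<^sup>L M (q n)) \<longlonglongrightarrow> 1"
  proof -
    have "integral\<^sup>L M (q n) = Im (of_real (real (Suc n)) * K (\<i> * of_real (real (Suc n))))" for n
      using ker_int[of "\<i> * of_real (real (Suc n))"] K_eq[of "\<i> * of_real (real (Suc n))"]
      unfolding q_eq[abs_def] by (simp add: a_def)
    moreover have "(\<lambda>n. Im (of_real (real (Suc n)) * K (\<i> * of_real (real (Suc n))))) \<longlonglongrightarrow> Im \<i>"
      by (intro tendsto_Im filterlim_compose[OF lim] filterlim_compose[OF filterlim_real_sequentially filterlim_Suc])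
    ultimately show ?thesis by simp
  qed
  have q_nonneg: "q n t \<ge> 0" for n t
    using \<kappa> c_le[of t] by (auto simp: q_def intro!: mult_nonneg_nonneg divide_nonneg_nonneg add_nonneg_nonneg)
  \<comment> \<open>Where \<open>c t = 1\<close>, the integrand \<open>q n t\<close> is
    \<open>\<kappa> * (Suc n)^2\<close>, whereas the integrals stay bounded; so infinity carries no
    mass.\<close>
  have c_AE: "AE t in M. c t \<noteq> 1"
  proof -
    define A where "A = {t. c t = 1}"
    have [measurable]: "A \<in> sets borel" unfolding A_def by measurable
    have le: "\<kappa> * (real (Suc n))\<^sup>2 * measure M A \<le> integral\<^sup>L M (q n)" for n
    proof -
      have "\<kappa> * (real (Suc n))\<^sup>2 * measure M A = (LINT t|M. \<kappa> * (real (Suc n))\<^sup>2 * indicator A t)"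
        by simp
      also have "\<dots> \<le> integral\<^sup>L M (q n)"
      proof (rule integral_mono)
        show "integrable M (\<lambda>t. \<kappa> * (real (Suc n))\<^sup>2 * indicator A t)"
          by (intro integrable_mult_right M.integrable_const_bound[where B = 1]) auto
        show "\<kappa> * (real (Suc n))\<^sup>2 * indicator A t \<le> q n t" for t
        proof (cases "t \<in> A")
          case True
          then show ?thesis by (simp add: A_def q_def)
        next
          case False
          then show ?thesis using q_nonneg by simp
        qed
      qed (rule q_int)
      finally show ?thesis .
    qed
    obtain B where B: "\<And>n. \<bar>integral\<^sup>L M (q n)\<bar> \<le> B"
      using convergent_imp_Bseq[OF convergentI[OF q_lim]] by (auto simp: Bseq_def)
    have "measure M A = 0"
    proof (rule ccontr)
      assume "measure M A \<noteq> 0"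
      then have pos: "\<kappa> * measure M A > 0" using \<kappa> by (simp add: less_le)
      obtain n :: nat where n: "B / (\<kappa> * measure M A) < real n" using reals_Archimedean2 by blast
      have "real n \<le> (real (Suc n))\<^sup>2" by (simp add: power2_eq_square algebra_simps)
      then have "B / (\<kappa> * measure M A) < (real (Suc n))\<^sup>2" using n by simp
      then have "B < \<kappa> * (real (Suc n))\<^sup>2 * measure M A"
        using pos by (simp add: divide_less_eq mult_ac)
      then show False using le[of n] B[of n] by simp
    qed
    then have "A \<in> null_sets M" by (intro null_setsI) (auto simp: M.emeasure_eq_measure)
    then have "AE t in M. t \<notin> A" by (rule AE_not_in)
    then show ?thesis by (simp add: A_def)
  qed
  have q_mono: "mono (\<lambda>n. q n t)" and q_tendsto: "(\<lambda>n. q n t) \<longlonglongrightarrow> p t" if "c t \<noteq> 1" for t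
  proof -
    have ct: "c t < 1" using that c_le[of t] by simp
    \<comment> \<open>Dividing by \<open>(Suc n)^2\<close> leaves \<open>n\<close> in a single
      decreasing term of the denominator, which exhibits both monotonicity and the limit.\<close>
    have eq: "q n t = \<kappa> * (2 / ((1 + c t) * (1 / (real (Suc n))\<^sup>2) + (1 - c t)))" for n
    proof -
      define m where "m = (real (Suc n))\<^sup>2"
      have m: "m > 0" by (simp add: m_def)
      have "m * ((1 + c t) * (1 / m) + (1 - c t)) = (1 + c t) + m * (1 - c t)"
        using m by (simp add: field_simps)
      then have "2 * m / ((1 + c t) + m * (1 - c t)) = 2 * m / (m * ((1 + c t) * (1 / m) + (1 - c t)))"
        by simp
      also have "\<dots> = 2 / ((1 + c t) * (1 / m) + (1 - c t))" using m by simp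
      finally show ?thesis unfolding q_def m_def by simp
    qed
    show "mono (\<lambda>n. q n t)"
    proof (rule monoI)
      fix i j :: nat assume "i \<le> j"
      then have "1 / (real (Suc j))\<^sup>2 \<le> 1 / (real (Suc i))\<^sup>2"
        by (intro divide_left_mono power_mono) auto
      then have "(1 + c t) * (1 / (real (Suc j))\<^sup>2) + (1 - c t) \<le> (1 + c t) * (1 / (real (Suc i))\<^sup>2) + (1 - c t)"
        using c_le[of t] by (intro add_mono mult_left_mono) auto
      moreover have "0 < (1 + c t) * (1 / (real (Suc j))\<^sup>2) + (1 - c t)"
        using ct c_le[of t] by (intro add_nonneg_pos) auto
      ultimately show "q i t \<le> q j t"
        unfolding eq using \<kappa> by (intro mult_left_mono divide_left_mono mult_pos_pos) auto
    qed
    have "(\<lambda>n. inverse (real (Suc n)) ^ 2) \<longlonglongrightarrow> 0 ^ 2"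
      by (intro tendsto_power LIMSEQ_inverse_real_of_nat)
    then have "(\<lambda>n. 1 / (real (Suc n))\<^sup>2) \<longlonglongrightarrow> 0" by (simp add: inverse_eq_divide power_divide)
    then have "(\<lambda>n. q n t) \<longlonglongrightarrow> \<kappa> * (2 / ((1 + c t) * 0 + (1 - c t)))"
      unfolding eq using ct by (intro tendsto_intros) auto
    then show "(\<lambda>n. q n t) \<longlonglongrightarrow> p t" by (simp add: p_def)
  qed
  have p_nonneg: "p t \<ge> 0" for t using \<kappa> c_le[of t] by (simp add: p_def)
  have mono_AE: "AE t in M. mono (\<lambda>n. q n t)" and tendsto_AE: "AE t in M. (\<lambda>n. q n t) \<longlonglongrightarrow> p t"
    using c_AE q_mono q_tendsto by (auto elim: eventually_mono)
  have p_int: "integrable M p" and p_1: "integral\<^sup>L M p = 1"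
    using integral_monotone_convergence_nonneg[OF q_int mono_AE _ tendsto_AE q_lim] q_nonneg by auto
  \<comment> \<open>Off the null set, \<open>p\<close> is \<open>\<kappa> * (1 + x^2)\<close>, the
    weight produced by the kernel; its total mass is the limit 1 of the integrals of
    \<open>q n\<close>.\<close>
  define D where "D = density M (\<lambda>t. ennreal (p t))"
  have "emeasure D (space D) = (\<integral>\<^sup>+t. ennreal (p t) \<partial>M)"
    by (simp add: D_def emeasure_density)
  also have "\<dots> = 1" using nn_integral_eq_integral[OF p_int] p_nonneg p_1 by simp
  finally interpret D: prob_space D by (rule prob_spaceI)
  have [measurable]: "x \<in> borel_measurable D" by (simp add: D_def)
  define \<rho> where "\<rho> = distr D borel x"
  have \<rho>: "real_distribution \<rho>"
    unfolding \<rho>_def by (rule D.real_distribution_distr) simp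
  have G_\<rho>: "cauchy_G \<rho> z = (LINT t|M. of_real (p t) * (1 / (z - of_real (x t))))" for z
  proof -
    have "cauchy_G \<rho> z = (LINT t|D. 1 / (z - of_real (x t)))"
      unfolding cauchy_G_def \<rho>_def by (rule integral_distr) simp_all
    also have "\<dots> = (LINT t|M. p t *\<^sub>R (1 / (z - of_real (x t))))"
      unfolding D_def using p_nonneg by (intro integral_density) auto
    finally show ?thesis by (simp only: scaleR_conv_of_real)
  qed
  \<comment> \<open>To integrate the two parts of the kernel separately, \<open>x\<close> must be
    integrable by itself; it is, as \<open>\<bar>x\<bar> \<le> 1 + x^2 = p / \<kappa>\<close> almost
    everywhere.\<close>
  have x_int: "integrable M x"
  proof (rule Bochner_Integration.integrable_bound)
    show "integrable M (\<lambda>t. p t / \<kappa>)" using p_int by simp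
    show "AE t in M. norm (x t) \<le> norm (p t / \<kappa>)"
      using c_AE
    proof eventually_elim
      case (elim t)
      have "0 \<le> (\<bar>x t\<bar> - 1)\<^sup>2 + \<bar>x t\<bar>" by simp
      then have "\<bar>x t\<bar> \<le> 1 + (x t)\<^sup>2" by (simp add: power2_eq_square algebra_simps abs_if split: if_splits)
      then have "\<bar>x t\<bar> \<le> p t / \<kappa>"
        using one_plus_cayley_pt_sq[of "2 * pi * t"] elim \<kappa> by (simp add: x_def p_def c_def)
      then show ?case using p_nonneg[of t] \<kappa> by simp
    qed
  qed simp
  have pG_int: "integrable M (\<lambda>t. of_real (p t) * (1 / (z - complex_of_real (x t))))" if z: "Im z > 0" for z
  proof (rule Bochner_Integration.integrable_bound)
    show "integrable M (\<lambda>t. p t * (1 / Im z))" using p_int by simp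
    have "norm (of_real (p t) * (1 / (z - complex_of_real (x t)))) \<le> p t * (1 / Im z)" for t
      unfolding norm_mult using norm_resolvent_le[OF z, of "x t"] p_nonneg[of t] by (intro mult_mono) auto
    then show "AE t in M. norm (of_real (p t) * (1 / (z - complex_of_real (x t)))) \<le> norm (p t * (1 / Im z))"
      unfolding real_norm_def by (intro AE_I2 order_trans[OF _ abs_ge_self])
  qed simp
  define b where "b = a - of_real (\<kappa> * integral\<^sup>L M x)"
  have K_G: "K z = b - cauchy_G \<rho> z" if z: "Im z > 0" for z
  proof -
    have "\<i> * of_real \<kappa> * (LINT t|M. ker z t) = (LINT t|M. \<i> * of_real \<kappa> * ker z t)"
      by (rule integral_mult_right_zero[symmetric])
    also have "\<dots> = (LINT t|M. - (of_real (p t) * (1 / (z - of_real (x t)))) - of_real (\<kappa> * x t))"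
    proof (rule integral_cong_AE)
      show "AE t in M. \<i> * of_real \<kappa> * ker z t = - (of_real (p t) * (1 / (z - of_real (x t)))) - of_real (\<kappa> * x t)"
        using c_AE
      proof eventually_elim
        case (elim t)
        have "\<i> * of_real \<kappa> * ker z t = of_real \<kappa> * (\<i> * ker z t)" by simp
        also have "\<i> * ker z t = - (of_real (2 / (1 - c t)) * (1 / (z - of_real (x t)))) - of_real (x t)"
          unfolding ker_def c_def x_def using elim by (intro herglotz_kernel_cayley z) (simp add: c_def)
        also have "of_real \<kappa> * \<dots> = - (of_real \<kappa> * of_real (2 / (1 - c t)) * (1 / (z - of_real (x t)))) - of_real \<kappa> * of_real (x t)"
          by (simp only: right_diff_distrib mult_minus_right mult.assoc)
        finally show ?case unfolding p_def of_real_mult .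
      qed
    qed (use ker_meas[OF z] in auto)
    also have "\<dots> = - cauchy_G \<rho> z - of_real (\<kappa> * integral\<^sup>L M x)"
      unfolding G_\<rho> using pG_int[OF z] x_int
      by (subst Bochner_Integration.integral_diff)
        (auto simp: integral_complex_of_real simp del: of_real_mult times_divide_eq_right mult_1_right)
    finally show ?thesis unfolding K_eq[OF z] b_def by simp
  qed
  \<comment> \<open>On the imaginary axis \<open>K\<close> tends to 0 by the growth condition and
    \<open>cauchy_G \<rho>\<close> is at most \<open>1 / y\<close>, so the remaining constant
    vanishes.\<close>
  have "b = 0"
  proof -
    have "((\<lambda>y. K (\<i> * of_real y)) \<longlongrightarrow> 0) at_top"
    proof -
      have "((\<lambda>y. complex_of_real (inverse y) * (of_real y * K (\<i> * of_real y))) \<longlongrightarrow> of_real 0 * \<i>) at_top"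
        by (intro tendsto_intros lim tendsto_inverse_0_at_top filterlim_ident)
      moreover have "eventually (\<lambda>y. complex_of_real (inverse y) * (of_real y * K (\<i> * of_real y)) = K (\<i> * of_real y)) at_top"
        using eventually_gt_at_top[of 0] by eventually_elim simp
      ultimately show ?thesis using Lim_transform_eventually by fastforce
    qed
    moreover have "((\<lambda>y. cauchy_G \<rho> (\<i> * of_real y)) \<longlongrightarrow> 0) at_top"
    proof (rule Lim_null_comparison)
      show "((\<lambda>y::real. inverse y) \<longlongrightarrow> 0) at_top" by (intro tendsto_inverse_0_at_top filterlim_ident)
      show "\<forall>\<^sub>F y in at_top. norm (cauchy_G \<rho> (\<i> * of_real y)) \<le> inverse y"
        using eventually_gt_at_top[of 0]
      proof eventually_elim
        case (elim y)
        interpret \<rho>: real_distribution \<rho> by fact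
        have "norm (cauchy_G \<rho> (\<i> * of_real y)) \<le> (LINT t|\<rho>. 1 / y)"
          unfolding cauchy_G_def using norm_resolvent_le[of "\<i> * of_real y"] elim \<rho>.integrable_resolvent[of "\<i> * of_real y"]
          by (intro Bochner_Integration.integral_norm_bound_integral) auto
        then show ?case by (simp add: inverse_eq_divide)
      qed
    qed
    ultimately have "((\<lambda>y. K (\<i> * of_real y) + cauchy_G \<rho> (\<i> * of_real y)) \<longlongrightarrow> 0 + 0) at_top"
      by (rule tendsto_add)
    moreover have "eventually (\<lambda>y. K (\<i> * of_real y) + cauchy_G \<rho> (\<i> * of_real y) = b) at_top"
      using eventually_gt_at_top[of 0] by eventually_elim (simp add: K_G)
    ultimately have "((\<lambda>y::real. b) \<longlongrightarrow> 0) at_top"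
      using Lim_transform_eventually by fastforce
    then show ?thesis by (simp add: tendsto_const_iff)
  qed
  then show ?thesis using \<rho> K_G by auto
qed

text \<open>The representation applies to \<open>K = - 1 / f\<close>, which maps the half-plane into
  itself; on the imaginary axis
  \<open>y * K (\<i> * y) = \<i> / (f (\<i> * y) / (\<i> * y))\<close>, which tends to
  \<open>\<i>\<close> because \<open>f\<close> is asymptotic to the identity.\<close>

theorem nevanlinna_cauchy_F:
  assumes f: "f holomorphic_on {z. Im z > 0}" "\<And>z. Im z > 0 \<Longrightarrow> Im (f z) \<ge> Im z" "asymp_id f"
  shows "\<exists>\<rho>. real_prob \<rho> \<and> (\<forall>z. Im z > 0 \<longrightarrow> cauchy_F \<rho> z = f z)"
proof -
  have f_pos: "Im (f z) > 0" if "Im z > 0" for z using f(2)[OF that] that by simp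
  then have f_nz: "f z \<noteq> 0" if "Im z > 0" for z using that by fastforce
  define K where "K z = - 1 / f z" for z
  have "\<exists>\<rho>. real_distribution \<rho> \<and> (\<forall>z. Im z > 0 \<longrightarrow> K z = - cauchy_G \<rho> z)"
  proof (rule cauchy_G_representation)
    show "K holomorphic_on {z. Im z > 0}"
      unfolding K_def[abs_def] using f_nz by (intro holomorphic_intros f) auto
    show "Im (K z) > 0" if "Im z > 0" for z
      using f_pos[OF that] f_nz[OF that]
      by (simp add: K_def Im_divide complex_eq_iff) (smt (verit) divide_pos_pos zero_less_power2 sum_power2_gt_zero_iff)
    have "((\<lambda>y. f (\<i> * of_real y) / (\<i> * of_real y) - 1) \<longlongrightarrow> 0) at_top"
    proof (rule tendstoI)
      fix e :: real assume e: "e > 0"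
      have "eventually (\<lambda>z. norm (f z - z) \<le> e / 2 * Im z) high_cone"
        using f(3)[unfolded asymp_id_def, rule_format, of "e / 2"] e by simp
      from eventually_compose_filterlim[OF this high_cone_imaginary_axis]
      have "\<forall>\<^sub>F y in at_top. norm (f (Complex 0 y) - Complex 0 y) \<le> e / 2 * y" by simp
      then show "\<forall>\<^sub>F y in at_top. dist (f (\<i> * of_real y) / (\<i> * of_real y) - 1) 0 < e"
        using eventually_gt_at_top[of 0]
      proof eventually_elim
        case (elim y)
        have y: "Complex 0 y = \<i> * of_real y" by (simp add: complex_eq_iff)
        have "f (\<i> * of_real y) / (\<i> * of_real y) - 1 = (f (\<i> * of_real y) - \<i> * of_real y) / (\<i> * of_real y)"
          using elim by (simp add: field_simps)
        then have "norm (f (\<i> * of_real y) / (\<i> * of_real y) - 1) = norm (f (\<i> * of_real y) - \<i> * of_real y) / y"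
          using elim by (simp add: norm_divide norm_mult)
        also have "\<dots> \<le> e / 2" using elim unfolding y by (simp add: divide_le_eq)
        finally show ?case using e by simp
      qed
    qed
    then have "((\<lambda>y. \<i> / (f (\<i> * of_real y) / (\<i> * of_real y) - 1 + 1)) \<longlongrightarrow> \<i> / (0 + 1)) at_top"
      by (intro tendsto_intros) auto
    moreover have "eventually (\<lambda>y. \<i> / (f (\<i> * of_real y) / (\<i> * of_real y) - 1 + 1) = of_real y * K (\<i> * of_real y)) at_top"
      using eventually_gt_at_top[of 0]
    proof eventually_elim
      case (elim y)
      have "f (\<i> * of_real y) \<noteq> 0" using f_nz[of "\<i> * of_real y"] elim by simp
      then show ?case using elim by (simp add: K_def field_simps)
    qed
    ultimately show "((\<lambda>y. of_real y * K (\<i> * of_real y)) \<longlongrightarrow> \<i>) at_top"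
      using Lim_transform_eventually by fastforce
  qed
  then obtain \<rho> where \<rho>: "real_distribution \<rho>" "\<And>z. Im z > 0 \<Longrightarrow> K z = - cauchy_G \<rho> z" by blast
  have "cauchy_F \<rho> z = f z" if z: "Im z > 0" for z
    using \<rho>(2)[OF z] by (simp add: cauchy_F_def K_def)
      (metis (no_types, lifting) divide_divide_eq_right div_by_1 mult_1)
  then show ?thesis using \<rho>(1) real_prob_iff_real_distribution by blast
qed

section \<open>Subordination functions\<close>

lemma open_upper_half_plane: "open {z. Im z > 0}"
  by (rule open_halfspace_Im_gt)

lemma connected_upper_half_plane: "connected {z. Im z > 0}"
  by (intro convex_connected convex_halfspace_Im_gt)

lemma open_tcone: "open (tcone l N)"
proof -
  have "tcone l N = {z. 0 < Im z} \<inter> {z. \<bar>Re z\<bar> < l * Im z} \<inter> {z. N < Im z}"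
    by (auto simp: tcone_def)
  also have "open \<dots>"
    by (intro open_Int open_Collect_less continuous_intros)
  finally show ?thesis .
qed

lemma tcone_nonempty: "l > 0 \<Longrightarrow> tcone l N \<noteq> {}"
proof -
  assume "l > 0"
  then have "Complex 0 (max N 0 + 1) \<in> tcone l N" by (auto simp: tcone_def)
  then show ?thesis by blast
qed

lemma eq_on_upper_half_plane:
  assumes "f holomorphic_on {z. Im z > 0}" "g holomorphic_on {z. Im z > 0}"
    and "eventually (\<lambda>z. f z = g z) high_cone" and "Im z > 0"
  shows "f z = g z"
proof -
  obtain l N where "l > 0" "\<And>z. z \<in> tcone l N \<Longrightarrow> f z = g z"
    using assms(3) by (auto simp: eventually_high_cone)
  then show ?thesis
    using analytic_continuation_open[OF open_tcone[of l N] open_upper_half_plane tcone_nonempty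
        connected_upper_half_plane _ assms(1,2), of z] assms(4) tcone_Im_pos by blast
qed

text \<open>The fixed point \<open>\<omega> z\<close> of \<open>w \<mapsto> z + p (z + q w)\<close> is found by iteration only high up in a cone,
  where the map contracts. On the whole half-plane a subsequence of the iterates \<open>g n\<close> converges by
  Montel's theorem applied to \<open>1 / (g n + \<i>)\<close>; passing to the shifted sequence too, both limits agree in the
  cone and hence everywhere, and Hurwitz's theorem excludes that the limit is infinite.\<close>

lemma exists_holomorphic_fixed_point:
  fixes p q :: "complex \<Rightarrow> complex"
  assumes holo: "p holomorphic_on {z. Im z > 0}" "q holomorphic_on {z. Im z > 0}"
    and Im_p: "\<And>z. Im z > 0 \<Longrightarrow> Im (p z) \<ge> 0" and Im_q: "\<And>z. Im z > 0 \<Longrightarrow> Im (q z) \<ge> 0"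
    and small: "\<And>d. d > 0 \<Longrightarrow> \<exists>N>0. \<forall>u\<in>tcone 1 N. norm (p u) \<le> d * Im u \<and> norm (q u) \<le> d * Im u"
    and lip: "\<exists>N>0. \<forall>u\<in>tcone 1 N. \<forall>v\<in>tcone 1 N.
      norm (p u - p v) \<le> 1 / 2 * norm (u - v) \<and> norm (q u - q v) \<le> norm (u - v)"
  obtains \<omega> where "\<omega> holomorphic_on {z. Im z > 0}"
    "\<And>z. Im z > 0 \<Longrightarrow> Im (\<omega> z) \<ge> Im z" "asymp_id \<omega>"
    "\<And>z. Im z > 0 \<Longrightarrow> \<omega> z = z + p (z + q (\<omega> z))"
proof -
  define T where "T z w = z + p (z + q w)" for z w
  define g where "g n z = (T z ^^ n) z" for n z
  have g_Suc: "g (Suc n) z = T z (g n z)" and g_0: "g 0 z = z" for n z by (simp_all add: g_def)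
  have Im_T: "Im (T z w) \<ge> Im z" if "Im z > 0" "Im w > 0" for z w
    using that Im_q[of w] Im_p[of "z + q w"] by (simp add: T_def)
  have Im_g: "Im (g n z) \<ge> Im z" if "Im z > 0" for n z
  proof (induction n)
    case (Suc n)
    then show ?case unfolding g_Suc using that by (intro Im_T) auto
  qed (simp add: g_0)
  have holo_g: "g n holomorphic_on {z. Im z > 0}" for n
  proof (induction n)
    case 0
    then show ?case by (simp add: g_0[abs_def])
  next
    case (Suc n)
    have 1: "(\<lambda>z. q (g n z)) holomorphic_on {z. Im z > 0}"
      using holomorphic_on_compose_gen[OF Suc holo(2)] Im_g[of _ n] by (force simp: o_def)
    have "Im (z + q (g n z)) > 0" if "Im z > 0" for z
      using Im_q[of "g n z"] Im_g[OF that, of n] that by simp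
    then have "(\<lambda>z. p (z + q (g n z))) holomorphic_on {z. Im z > 0}"
      using holomorphic_on_compose_gen[OF holomorphic_on_add[OF holomorphic_on_ident 1] holo(1)]
      by (auto simp: o_def image_subset_iff)
    then show ?case unfolding g_Suc[abs_def] T_def by (intro holomorphic_intros)
  qed
  \<comment> \<open>At radius \<open>1 / 4 * Im z\<close>, \<open>tcone_perturb\<close> keeps points
    near \<open>z\<close> inside \<open>tcone 1 N\<close>; \<open>d \<le> 1 / 8\<close> makes
    \<open>2 * d * Im z\<close> at most this radius, so the iteration stays in the disc.
    \<open>N0\<close> allows the cone to be raised to where the Lipschitz bounds hold.\<close>
  have near: "\<exists>N>0. N \<ge> N0 \<and> (\<forall>z\<in>tcone (1 / 4) (2 * N). \<forall>w. norm (w - z) \<le> 1 / 4 * Im z \<longrightarrow>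
       w \<in> tcone 1 N \<and> z + q w \<in> tcone 1 N \<and> norm (T z w - z) \<le> 2 * d * Im z)"
    if d: "0 < d" "d \<le> 1 / 8" for d N0
  proof -
    obtain N1 where N1: "N1 > 0" and pq1: "\<And>u. u \<in> tcone 1 N1 \<Longrightarrow> norm (p u) \<le> d * Im u"
        "\<And>u. u \<in> tcone 1 N1 \<Longrightarrow> norm (q u) \<le> d * Im u"
      using small[OF d(1)] by blast
    define N where "N = max N0 N1"
    have N: "N > 0" "N \<ge> N0" using N1 by (auto simp: N_def)
    have sub: "tcone 1 N \<subseteq> tcone 1 N1" by (rule tcone_mono) (auto simp: N_def)
    have pq: "norm (p u) \<le> d * Im u" "norm (q u) \<le> d * Im u" if "u \<in> tcone 1 N" for u
      using that pq1[of u] sub by auto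
    have "w \<in> tcone 1 N \<and> z + q w \<in> tcone 1 N \<and> norm (T z w - z) \<le> 2 * d * Im z"
      if z: "z \<in> tcone (1 / 4) (2 * N)" and w: "norm (w - z) \<le> 1 / 4 * Im z" for z w
    proof -
      have Imz: "Im z > 0" using z by (rule tcone_Im_pos)
      have in_cone: "u \<in> tcone 1 N" if "norm (u - z) \<le> 1 / 4 * Im z" for u
        using tcone_perturb[of z 1 N "1 / 4" u] z that by simp
      have Im_le: "d * Im u \<le> 2 * d * Im z" if "norm (u - z) \<le> 1 / 4 * Im z" for u
      proof -
        have "Im u \<le> 2 * Im z" using abs_Im_le_cmod[of "u - z"] that Imz by simp
        then show ?thesis using mult_left_mono[of "Im u" "2 * Im z" d] d by simp
      qed
      have le: "2 * d * Im z \<le> 1 / 4 * Im z" using d Imz by (intro mult_right_mono) auto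
      have u: "norm (z + q w - z) \<le> 1 / 4 * Im z"
        using pq(2)[OF in_cone[OF w]] Im_le[OF w] le by simp
      have "norm (T z w - z) \<le> 2 * d * Im z"
        using pq(1)[OF in_cone[OF u]] Im_le[OF u] by (simp add: T_def)
      then show ?thesis using in_cone[OF w] in_cone[OF u] by blast
    qed
    then show ?thesis using N by blast
  qed
  have g_near: "\<exists>N>0. \<forall>z\<in>tcone (1 / 4) (2 * N). \<forall>n. norm (g n z - z) \<le> 2 * d * Im z"
    if d: "0 < d" "d \<le> 1 / 8" for d
  proof -
    obtain N where N: "N > 0" and T: "\<And>z w. z \<in> tcone (1 / 4) (2 * N) \<Longrightarrow> norm (w - z) \<le> 1 / 4 * Im z
        \<Longrightarrow> norm (T z w - z) \<le> 2 * d * Im z"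
      using near[OF d] by blast
    have "norm (g n z - z) \<le> 2 * d * Im z" if z: "z \<in> tcone (1 / 4) (2 * N)" for n z
    proof (induction n)
      case 0
      then show ?case using tcone_Im_pos[OF z] d by (simp add: g_0)
    next
      case (Suc n)
      have "2 * d * Im z \<le> 1 / 4 * Im z" using d tcone_Im_pos[OF z] by (intro mult_right_mono) auto
      then show ?case unfolding g_Suc using T[OF z] Suc by simp
    qed
    then show ?thesis using N by blast
  qed
  \<comment> \<open>\<open>p\<close> contributes the factor 1/2 and \<open>q\<close> the factor 1,
    so each step of the iteration halves the increments.\<close>
  obtain N where N: "N > 0" and g_close: "\<And>z n. z \<in> tcone (1 / 4) N \<Longrightarrow> norm (g n z - z) \<le> 1 / 4 * Im z"
    and g_diff: "\<And>z n. z \<in> tcone (1 / 4) N \<Longrightarrow> norm (g (Suc n) z - g n z) \<le> (1 / 2) ^ n * (1 / 4 * Im z)"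
  proof -
    obtain N1 where N1: "N1 > 0" and c1: "\<And>z n. z \<in> tcone (1 / 4) (2 * N1) \<Longrightarrow> norm (g n z - z) \<le> 1 / 4 * Im z"
      using g_near[of "1 / 8"] by auto
    obtain N3 where N3: "N3 > 0"
      and lp: "\<And>u v. u \<in> tcone 1 N3 \<Longrightarrow> v \<in> tcone 1 N3 \<Longrightarrow> norm (p u - p v) \<le> 1 / 2 * norm (u - v)"
      and lq: "\<And>u v. u \<in> tcone 1 N3 \<Longrightarrow> v \<in> tcone 1 N3 \<Longrightarrow> norm (q u - q v) \<le> norm (u - v)"
      using lip by blast
    obtain N2 where N2: "N2 > 0" "N2 \<ge> N3" and c2: "\<And>z w. z \<in> tcone (1 / 4) (2 * N2) \<Longrightarrow>
        norm (w - z) \<le> 1 / 4 * Im z \<Longrightarrow> w \<in> tcone 1 N2 \<and> z + q w \<in> tcone 1 N2"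
      using near[of "1 / 8" N3] by auto
    define N where "N = 2 * max N1 N2"
    have "tcone 1 N2 \<subseteq> tcone 1 N3" by (rule tcone_mono) (use N2 in auto)
    moreover have sub: "tcone (1 / 4) N \<subseteq> tcone (1 / 4) (2 * N1)" "tcone (1 / 4) N \<subseteq> tcone (1 / 4) (2 * N2)"
      by (rule tcone_mono; simp add: N_def)+
    ultimately have c2': "w \<in> tcone 1 N3" "z + q w \<in> tcone 1 N3"
      if "z \<in> tcone (1 / 4) N" "norm (w - z) \<le> 1 / 4 * Im z" for z w
      using c2[OF subsetD[OF sub(2) that(1)] that(2)] by auto
    have c1': "norm (g n z - z) \<le> 1 / 4 * Im z" if "z \<in> tcone (1 / 4) N" for n z
      using c1 that sub(1) by blast
    have T_contr: "norm (T z w - T z w') \<le> 1 / 2 * norm (w - w')"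
      if "z \<in> tcone (1 / 4) N" "norm (w - z) \<le> 1 / 4 * Im z" "norm (w' - z) \<le> 1 / 4 * Im z" for z w w'
    proof -
      have "norm (p (z + q w) - p (z + q w')) \<le> 1 / 2 * norm (q w - q w')"
        using lp[OF c2'(2)[OF that(1,2)] c2'(2)[OF that(1,3)]] by simp
      moreover have "norm (q w - q w') \<le> norm (w - w')"
        using lq[OF c2'(1)[OF that(1,2)] c2'(1)[OF that(1,3)]] .
      ultimately show ?thesis by (simp add: T_def)
    qed
    have gd: "norm (g (Suc n) z - g n z) \<le> (1 / 2) ^ n * (1 / 4 * Im z)" if z: "z \<in> tcone (1 / 4) N" for n z
    proof (induction n)
      case 0
      then show ?case using c1'[OF z, of 1] by (simp add: g_0)
    next
      case (Suc n)
      have "norm (g (Suc (Suc n)) z - g (Suc n) z) \<le> 1 / 2 * norm (g (Suc n) z - g n z)"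
        using T_contr[OF z c1'[OF z] c1'[OF z], of "Suc n" n] unfolding g_Suc[symmetric] .
      then show ?case using Suc by simp
    qed
    have "N > 0" using N1 by (simp add: N_def)
    then show thesis by (rule that[OF _ c1' gd])
  qed
  define h where "h n z = 1 / (g n z + \<i>)" for n z
  have g_nz: "g n z + \<i> \<noteq> 0" if "Im z > 0" for n z
    using Im_g[OF that, of n] that by (auto simp: complex_eq_iff)
  have holo_h: "h n holomorphic_on {z. Im z > 0}" for n
    unfolding h_def[abs_def] using g_nz by (intro holomorphic_intros holo_g) auto
  have norm_h: "norm (h n z) \<le> 1" if "Im z > 0" for n z
  proof -
    have "1 \<le> Im (g n z + \<i>)" using Im_g[OF that, of n] that by simp
    then have "norm (1 / (g n z + \<i> - of_real 0)) \<le> 1 / Im (g n z + \<i>)" "1 / Im (g n z + \<i>) \<le> 1 / 1"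
      by (intro norm_resolvent_le divide_left_mono; simp)+
    then have "norm (1 / (g n z + \<i> - of_real 0)) \<le> 1" by simp
    then show ?thesis unfolding h_def by (simp only: of_real_0 diff_0_right)
  qed
  have montel: "\<exists>c r. c holomorphic_on {z. Im z > 0} \<and> strict_mono (r :: nat \<Rightarrow> nat) \<and>
      (\<forall>z. Im z > 0 \<longrightarrow> (\<lambda>n. h (s (r n)) z) \<longlonglongrightarrow> c z) \<and>
      (\<forall>K. compact K \<longrightarrow> K \<subseteq> {z. Im z > 0} \<longrightarrow> uniform_limit K (\<lambda>n. h (s (r n))) c sequentially)" for s
  proof (rule Montel[OF open_upper_half_plane, of "range h" "\<lambda>n. h (s n)"])
    show "\<And>f. f \<in> range h \<Longrightarrow> f holomorphic_on {z. 0 < Im z}" using holo_h by auto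
    show "\<exists>B. \<forall>f\<in>range h. \<forall>z\<in>K. norm (f z) \<le> B" if "K \<subseteq> {z. 0 < Im z}" for K
      using norm_h that by (intro exI[of _ 1]) auto
    show "range (\<lambda>n. h (s n)) \<subseteq> range h" by auto
  next
    fix c :: "complex \<Rightarrow> complex" and r :: "nat \<Rightarrow> nat"
    assume "c holomorphic_on {z. Im z > 0}" "strict_mono r"
      "\<And>z. z \<in> {z. Im z > 0} \<Longrightarrow> (\<lambda>n. h (s (r n)) z) \<longlonglongrightarrow> c z"
      "\<And>K. compact K \<Longrightarrow> K \<subseteq> {z. Im z > 0} \<Longrightarrow> uniform_limit K ((\<lambda>n. h (s n)) \<circ> r) c sequentially"
    then show ?thesis by (intro exI[of _ c] exI[of _ r]) (auto simp: o_def)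
  qed
  obtain c r where c: "c holomorphic_on {z. Im z > 0}" and r: "strict_mono (r :: nat \<Rightarrow> nat)"
    and c_lim: "\<And>z. Im z > 0 \<Longrightarrow> (\<lambda>n. h (r n) z) \<longlonglongrightarrow> c z"
    and c_unif: "\<And>K. compact K \<Longrightarrow> K \<subseteq> {z. Im z > 0} \<Longrightarrow> uniform_limit K (\<lambda>n. h (r n)) c sequentially"
    using montel[of "\<lambda>n. n"] by auto
  obtain c' r' where c': "c' holomorphic_on {z. Im z > 0}" and r': "strict_mono (r' :: nat \<Rightarrow> nat)"
    and c'_lim: "\<And>z. Im z > 0 \<Longrightarrow> (\<lambda>n. h (Suc (r (r' n))) z) \<longlonglongrightarrow> c' z"
    using montel[of "\<lambda>n. Suc (r n)"] by auto
  have c_lim': "(\<lambda>n. h (r (r' n)) z) \<longlonglongrightarrow> c z" if "Im z > 0" for z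
    using LIMSEQ_subseq_LIMSEQ[OF c_lim[OF that] r'] by (simp add: o_def)
  \<comment> \<open>In the cone the iterates stay near \<open>z\<close>, so \<open>h n z\<close> is
    bounded away from 0. This rules out the limit that is identically 0, which Hurwitz's theorem
    alone would leave open.\<close>
  have c_ge: "norm (c z) \<ge> 1 / (norm z + 1 / 4 * Im z + 1)" if z: "z \<in> tcone (1 / 4) N" for z
  proof (rule tendsto_lowerbound[OF tendsto_norm[OF c_lim]])
    show Imz: "Im z > 0" by (rule tcone_Im_pos[OF z])
    have "norm (h n z) \<ge> 1 / (norm z + 1 / 4 * Im z + 1)" for n
    proof -
      have "norm (g n z + \<i>) \<le> norm (g n z - z) + norm z + 1"
        using norm_triangle_ineq[of "g n z" \<i>] norm_triangle_ineq[of "g n z - z" z] by simp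
      then have "norm (g n z + \<i>) \<le> norm z + 1 / 4 * Im z + 1" using g_close[OF z, of n] by simp
      then show ?thesis using g_nz[OF Imz, of n] unfolding h_def norm_divide norm_one
        using Imz norm_ge_zero[of z] by (intro divide_left_mono mult_pos_pos) (linarith | simp)+
    qed
    then show "\<forall>\<^sub>F n in sequentially. 1 / (norm z + 1 / 4 * Im z + 1) \<le> norm (h (r n) z)" by simp
  qed simp
  have c_nz_cone: "c z \<noteq> 0" if z: "z \<in> tcone (1 / 4) N" for z
  proof -
    have "1 / (norm z + 1 / 4 * Im z + 1) > 0"
      using tcone_Im_pos[OF z] by (intro divide_pos_pos add_nonneg_pos add_nonneg_nonneg) auto
    then show ?thesis using c_ge[OF z] by auto
  qed
  have cc': "c z = c' z" if z: "z \<in> tcone (1 / 4) N" for z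
  proof -
    have Imz: "Im z > 0" by (rule tcone_Im_pos[OF z])
    have "(\<lambda>n. h (Suc n) z - h n z) \<longlonglongrightarrow> 0"
    proof (rule Lim_null_comparison)
      have "norm (h (Suc n) z - h n z) \<le> (1 / 2) ^ n * (1 / 4 * Im z)" for n
      proof -
        have "h (Suc n) z - h n z = (g n z - g (Suc n) z) * (h (Suc n) z * h n z)"
          unfolding h_def using g_nz[OF Imz, of n] g_nz[OF Imz, of "Suc n"] by (simp add: field_simps)
        then have "norm (h (Suc n) z - h n z) \<le> norm (g n z - g (Suc n) z) * (1 * 1)"
          unfolding norm_mult[symmetric]
          by (simp only: norm_mult) (intro mult_left_mono mult_mono norm_h[OF Imz]; simp)
        then show ?thesis using g_diff[OF z, of n] by (simp add: norm_minus_commute)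
      qed
      then show "\<forall>\<^sub>F n in sequentially. norm (h (Suc n) z - h n z) \<le> (1 / 2) ^ n * (1 / 4 * Im z)" by simp
      show "(\<lambda>n. (1 / 2) ^ n * (1 / 4 * Im z)) \<longlonglongrightarrow> 0"
        by (intro tendsto_mult_left_zero LIMSEQ_power_zero) simp
    qed
    from LIMSEQ_subseq_LIMSEQ[OF this strict_mono_o[OF r r']]
    have "(\<lambda>n. h (Suc (r (r' n))) z - h (r (r' n)) z) \<longlonglongrightarrow> 0" by (simp add: o_def)
    moreover have "(\<lambda>n. h (Suc (r (r' n))) z - h (r (r' n)) z) \<longlonglongrightarrow> c' z - c z"
      by (intro tendsto_diff c'_lim c_lim' Imz)
    ultimately show ?thesis using LIMSEQ_unique by fastforce
  qed
  have cc': "c z = c' z" if "Im z > 0" for z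
  proof (rule eq_on_upper_half_plane[OF c c' _ that])
    show "\<forall>\<^sub>F z in high_cone. c z = c' z"
      using eventually_in_tcone[of "1 / 4" N] by (auto elim!: eventually_mono simp: cc')
  qed
  obtain z1 where z1: "z1 \<in> tcone (1 / 4) N" using tcone_nonempty[of "1 / 4" N] by auto
  have c_nz: "c z \<noteq> 0" if "Im z > 0" for z
  proof (cases "c constant_on {z. Im z > 0}")
    case True
    then show ?thesis using c_nz_cone[OF z1] tcone_Im_pos[OF z1] that by (auto simp: constant_on_def)
  next
    case False
    show ?thesis
      by (rule Hurwitz_no_zeros[OF open_upper_half_plane connected_upper_half_plane, of "\<lambda>n. h (r n)"])
        (use holo_h c c_unif False g_nz that in \<open>auto simp: h_def\<close>)
  qed
  define \<omega> where "\<omega> z = 1 / c z - \<i>" for z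
  have g_h: "g n z = 1 / h n z - \<i>" for n z by (simp add: h_def)
  have lim: "(\<lambda>n. g (r (r' n)) z) \<longlonglongrightarrow> \<omega> z" if "Im z > 0" for z
    unfolding g_h \<omega>_def using c_nz[OF that] by (intro tendsto_intros c_lim' that)
  have lim': "(\<lambda>n. g (Suc (r (r' n))) z) \<longlonglongrightarrow> \<omega> z" if "Im z > 0" for z
    unfolding g_h \<omega>_def cc'[OF that] using c_nz[OF that] cc'[OF that] by (intro tendsto_intros c'_lim that) auto
  have Im_\<omega>: "Im (\<omega> z) \<ge> Im z" if "Im z > 0" for z
    by (rule tendsto_lowerbound[OF tendsto_Im[OF lim[OF that]]]) (use Im_g[OF that] in auto)
  have cont: "isCont f z" if "f holomorphic_on {z. Im z > 0}" "Im z > 0" for f z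
    using that holomorphic_on_imp_continuous_on continuous_on_eq_continuous_at[OF open_upper_half_plane]
    by blast
  show thesis
  proof (rule that)
    show "\<omega> holomorphic_on {z. Im z > 0}"
      unfolding \<omega>_def[abs_def] using c_nz by (intro holomorphic_intros c) auto
    show "\<And>z. Im z > 0 \<Longrightarrow> Im (\<omega> z) \<ge> Im z" by (rule Im_\<omega>)
    show "asymp_id \<omega>"
      unfolding asymp_id_def
    proof safe
      fix d :: real assume "d > 0"
      then have "0 < min (1 / 8) (d / 2)" "min (1 / 8) (d / 2) \<le> 1 / 8" by auto
      from g_near[OF this] obtain N where N: "N > 0" "\<And>n z. z \<in> tcone (1 / 4) (2 * N) \<Longrightarrow>
          norm (g n z - z) \<le> 2 * min (1 / 8) (d / 2) * Im z" by blast
      have "norm (\<omega> z - z) \<le> d * Im z" if z: "z \<in> tcone (1 / 4) (2 * N)" for z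
      proof (rule tendsto_upperbound[OF tendsto_norm[OF tendsto_diff[OF lim[OF tcone_Im_pos[OF z]] tendsto_const]]])
        have "2 * min (1 / 8) (d / 2) * Im z \<le> d * Im z"
          using tcone_Im_pos[OF z] by (intro mult_right_mono) auto
        then show "\<forall>\<^sub>F n in sequentially. norm (g (r (r' n)) z - z) \<le> d * Im z"
          using N(2)[OF z] order_trans by (intro always_eventually allI) blast
      qed simp
      then show "\<forall>\<^sub>F z in high_cone. norm (\<omega> z - z) \<le> d * Im z"
        using eventually_in_tcone[of "1 / 4" "2 * N"] by (auto elim!: eventually_mono)
    qed
    fix z assume z: "Im z > 0"
    have \<omega>_pos: "Im (\<omega> z) > 0" using Im_\<omega>[OF z] z by simp
    have "isCont q (\<omega> z)" "isCont p (z + q (\<omega> z))"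
      using cont[OF holo(2) \<omega>_pos] cont[OF holo(1), of "z + q (\<omega> z)"] Im_q[OF \<omega>_pos] z by auto
    \<comment> \<open>By continuity the recursion \<open>g (Suc k) z = T z (g k z)\<close> passes to
      the limit, both sequences of iterates tending to \<open>\<omega> z\<close>.\<close>
    then have "(\<lambda>n. T z (g (r (r' n)) z)) \<longlonglongrightarrow> T z (\<omega> z)"
      unfolding T_def by (intro tendsto_intros isCont_tendsto_compose[of _ p] isCont_tendsto_compose[of _ q] lim z)
    then have "(\<lambda>n. g (Suc (r (r' n))) z) \<longlonglongrightarrow> T z (\<omega> z)" unfolding g_Suc .
    from LIMSEQ_unique[OF lim'[OF z] this] show "\<omega> z = z + p (z + q (\<omega> z))"
      unfolding T_def .
  qed
qed

text \<open>Take \<open>p = H\<close> for \<open>\<nu>\<close> and \<open>q = H\<close> for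
  \<open>\<mu>\<close>, and put \<open>\<omega>2 = z + q \<omega>\<close>, which is the second
  equation. The fixed-point equation then reads \<open>\<omega> = z + p \<omega>2\<close>, so
  \<open>F \<nu> \<omega>2 = \<omega>2 + \<omega> - z = F \<mu> \<omega>\<close>. Both functions are
  in the Nevanlinna class, hence come from measures.\<close>

lemma exists_subordination:
  assumes "real_prob \<mu>" "real_prob \<nu>"
  obtains \<rho>1 \<rho>2 where "real_prob \<rho>1" "real_prob \<rho>2"
    "\<And>z. Im z > 0 \<Longrightarrow> cauchy_F \<mu> (cauchy_F \<rho>1 z) = cauchy_F \<nu> (cauchy_F \<rho>2 z)"
    "\<And>z. Im z > 0 \<Longrightarrow> cauchy_F \<rho>1 z + cauchy_F \<rho>2 z = z + cauchy_F \<mu> (cauchy_F \<rho>1 z)"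
proof -
  interpret \<mu>: real_distribution \<mu> by (rule real_probD) fact
  interpret \<nu>: real_distribution \<nu> by (rule real_probD) fact
  define p q where "p z = cauchy_F \<nu> z - z" and "q z = cauchy_F \<mu> z - z" for z
  have holo: "p holomorphic_on {z. Im z > 0}" "q holomorphic_on {z. Im z > 0}"
    unfolding p_def[abs_def] q_def[abs_def]
    by (intro holomorphic_intros \<mu>.holomorphic_cauchy_F \<nu>.holomorphic_cauchy_F)+
  have Im_p: "Im (p z) \<ge> 0" and Im_q: "Im (q z) \<ge> 0" if "Im z > 0" for z
    using \<mu>.Im_cauchy_F_ge[OF that] \<nu>.Im_cauchy_F_ge[OF that] by (simp_all add: p_def q_def)
  have small: "\<exists>N>0. \<forall>u\<in>tcone 1 N. norm (p u) \<le> d * Im u \<and> norm (q u) \<le> d * Im u" if d: "d > 0" for d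
  proof -
    obtain N1 where N1: "N1 > 0" "\<And>u. u \<in> tcone 1 N1 \<Longrightarrow> norm (p u) \<le> d * Im u"
      using \<nu>.cauchy_F_near_id[OF zero_less_one d] by (auto simp: p_def)
    obtain N2 where N2: "N2 > 0" "\<And>u. u \<in> tcone 1 N2 \<Longrightarrow> norm (q u) \<le> d * Im u"
      using \<mu>.cauchy_F_near_id[OF zero_less_one d] by (auto simp: q_def)
    have "tcone 1 (max N1 N2) \<subseteq> tcone 1 N1" "tcone 1 (max N1 N2) \<subseteq> tcone 1 N2"
      by (rule tcone_mono; simp)+
    then show ?thesis using N1 N2 by (intro exI[of _ "max N1 N2"]) auto
  qed
  have lip: "\<exists>N>0. \<forall>u\<in>tcone 1 N. \<forall>v\<in>tcone 1 N.
      norm (p u - p v) \<le> 1 / 2 * norm (u - v) \<and> norm (q u - q v) \<le> norm (u - v)"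
  proof (rule \<nu>.cauchy_F_cone_estimate[OF zero_less_one])
    show "(1 :: real) / 2 > 0" by simp
  next
    fix N1 :: real
    assume N1: "\<And>u v. u \<in> tcone 1 N1 \<Longrightarrow> v \<in> tcone 1 N1 \<Longrightarrow>
        norm ((cauchy_F \<nu> u - u) - (cauchy_F \<nu> v - v)) \<le> 1 / 2 * norm (u - v)"
    show "\<exists>N>0. \<forall>u\<in>tcone 1 N. \<forall>v\<in>tcone 1 N.
      norm (p u - p v) \<le> 1 / 2 * norm (u - v) \<and> norm (q u - q v) \<le> norm (u - v)"
    proof (rule \<mu>.cauchy_F_cone_estimate[OF zero_less_one zero_less_one])
      fix N2 :: real
      assume N2: "N2 > 0" "\<And>u v. u \<in> tcone 1 N2 \<Longrightarrow> v \<in> tcone 1 N2 \<Longrightarrow>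
        norm ((cauchy_F \<mu> u - u) - (cauchy_F \<mu> v - v)) \<le> 1 * norm (u - v)"
      have "tcone 1 (max N1 N2) \<subseteq> tcone 1 N1" "tcone 1 (max N1 N2) \<subseteq> tcone 1 N2"
        by (rule tcone_mono; simp)+
      then have "norm (p u - p v) \<le> 1 / 2 * norm (u - v) \<and> norm (q u - q v) \<le> norm (u - v)"
        if "u \<in> tcone 1 (max N1 N2)" "v \<in> tcone 1 (max N1 N2)" for u v
        using N1[of u v] N2(2)[of u v] that unfolding p_def q_def mult_1 by blast
      then show "\<exists>N>0. \<forall>u\<in>tcone 1 N. \<forall>v\<in>tcone 1 N.
          norm (p u - p v) \<le> 1 / 2 * norm (u - v) \<and> norm (q u - q v) \<le> norm (u - v)"
        using N2(1) by (intro exI[of _ "max N1 N2"]) auto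
    qed
  qed
  obtain \<omega> where \<omega>: "\<omega> holomorphic_on {z. Im z > 0}" "\<And>z. Im z > 0 \<Longrightarrow> Im (\<omega> z) \<ge> Im z" "asymp_id \<omega>"
    and fp: "\<And>z. Im z > 0 \<Longrightarrow> \<omega> z = z + p (z + q (\<omega> z))"
    using exists_holomorphic_fixed_point[OF holo Im_p Im_q small lip] by blast
  have \<omega>_pos: "Im (\<omega> z) > 0" if "Im z > 0" for z using \<omega>(2)[OF that] that by simp
  have F\<omega>: "(\<lambda>z. cauchy_F \<mu> (\<omega> z)) holomorphic_on {z. Im z > 0}"
    using holomorphic_on_compose_gen[OF \<omega>(1) \<mu>.holomorphic_cauchy_F] \<omega>_pos by (auto simp: o_def image_subset_iff)
  define \<omega>2 where "\<omega>2 z = z + q (\<omega> z)" for z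
  have \<omega>2_eq: "\<omega>2 z = z + cauchy_F \<mu> (\<omega> z) - \<omega> z" for z by (simp add: \<omega>2_def q_def)
  have \<omega>2_holo: "\<omega>2 holomorphic_on {z. Im z > 0}"
    unfolding \<omega>2_eq[abs_def] by (intro holomorphic_intros F\<omega> \<omega>)
  have Im_\<omega>2: "Im (\<omega>2 z) \<ge> Im z" if "Im z > 0" for z
    using Im_q[OF \<omega>_pos[OF that]] by (simp add: \<omega>2_def)
  have "asymp_id \<omega>2"
    unfolding asymp_id_def
  proof safe
    fix d :: real assume "d > 0"
    then have "d / 2 > 0" by simp
    then have "eventually (\<lambda>z. norm (cauchy_F \<mu> (\<omega> z) - z) \<le> d / 2 * Im z) high_cone"
      "eventually (\<lambda>z. norm (\<omega> z - z) \<le> d / 2 * Im z) high_cone"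
      using asymp_id_compose[OF \<mu>.asymp_id_cauchy_F \<omega>(3)] \<omega>(3) unfolding asymp_id_def by blast+
    then show "eventually (\<lambda>z. norm (\<omega>2 z - z) \<le> d * Im z) high_cone"
    proof eventually_elim
      case (elim z)
      have "\<omega>2 z - z = (cauchy_F \<mu> (\<omega> z) - z) - (\<omega> z - z)" by (simp add: \<omega>2_eq)
      then have "norm (\<omega>2 z - z) \<le> norm (cauchy_F \<mu> (\<omega> z) - z) + norm (\<omega> z - z)"
        by (simp only: norm_triangle_ineq4)
      then show ?case using elim by simp
    qed
  qed
  from nevanlinna_cauchy_F[OF \<omega>2_holo Im_\<omega>2 this]
  obtain \<rho>2 where \<rho>2: "real_prob \<rho>2" "\<And>z. Im z > 0 \<Longrightarrow> cauchy_F \<rho>2 z = \<omega>2 z" by blast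
  from nevanlinna_cauchy_F[OF \<omega>(1-3)]
  obtain \<rho>1 where \<rho>1: "real_prob \<rho>1" "\<And>z. Im z > 0 \<Longrightarrow> cauchy_F \<rho>1 z = \<omega> z" by blast
  show thesis
  proof (rule that[OF \<rho>1(1) \<rho>2(1)])
    fix z assume z: "Im z > 0"
    have "p (\<omega>2 z) = \<omega> z - z" unfolding \<omega>2_def using fp[OF z] by (metis add_diff_cancel_left')
    then show "cauchy_F \<mu> (cauchy_F \<rho>1 z) = cauchy_F \<nu> (cauchy_F \<rho>2 z)"
      unfolding \<rho>1(2)[OF z] \<rho>2(2)[OF z] p_def by (simp add: \<omega>2_eq algebra_simps)
    show "cauchy_F \<rho>1 z + cauchy_F \<rho>2 z = z + cauchy_F \<mu> (cauchy_F \<rho>1 z)"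
      unfolding \<rho>1(2)[OF z] \<rho>2(2)[OF z] by (simp add: \<omega>2_eq)
  qed
qed

section \<open>Free, monotone and subordination convolutions\<close>

lemma eventually_cauchy_F_inject:
  assumes "real_prob \<mu>" "real_prob \<nu>" "eventually (\<lambda>z. cauchy_F \<mu> z = cauchy_F \<nu> z) high_cone"
  shows "\<mu> = \<nu>"
  using assms real_probD
  by (intro cauchy_F_inject eq_on_upper_half_plane[of "cauchy_F \<mu>" "cauchy_F \<nu>"]
      real_distribution.holomorphic_cauchy_F)

text \<open>\<open>v + voiculescu \<nu> v\<close> is a right inverse of
  \<open>cauchy_F \<nu>\<close> near infinity. At \<open>v = cauchy_F \<mu> w\<close> the same
  expression with \<open>\<mu>\<close> equals \<open>w\<close>, so equal germs give
  \<open>cauchy_F \<nu> w = cauchy_F \<mu> w\<close>.\<close>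

lemma voiculescu_inject:
  assumes "real_prob \<mu>" "real_prob \<nu>" "eventually (\<lambda>v. voiculescu \<mu> v = voiculescu \<nu> v) high_cone"
  shows "\<mu> = \<nu>"
proof -
  interpret \<mu>: real_distribution \<mu> by (rule real_probD) fact
  interpret \<nu>: real_distribution \<nu> by (rule real_probD) fact
  have K: "eventually (\<lambda>v. cauchy_F \<nu> (v + voiculescu \<nu> v) = v) high_cone"
    unfolding \<nu>.eventually_cauchy_F_iff[of "\<lambda>v. cauchy_F \<nu> (v + voiculescu \<nu> v) = v", symmetric]
    using \<nu>.voiculescu_cauchy_F by eventually_elim simp
  have "eventually (\<lambda>v. cauchy_F \<nu> (v + voiculescu \<mu> v) = v) high_cone"
    using assms(3) K by eventually_elim simp
  then have "eventually (\<lambda>w. cauchy_F \<nu> (cauchy_F \<mu> w + voiculescu \<mu> (cauchy_F \<mu> w)) = cauchy_F \<mu> w) high_cone"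
    by (rule eventually_compose_filterlim[OF _ \<mu>.filterlim_cauchy_F])
  then have "eventually (\<lambda>w. cauchy_F \<mu> w = cauchy_F \<nu> w) high_cone"
    using \<mu>.voiculescu_cauchy_F by eventually_elim simp
  then show ?thesis by (intro eventually_cauchy_F_inject assms)
qed

text \<open>Translates the defining condition of \<open>free_conv\<close>, with its common cone and
  chosen inverses, into additivity of germs. Intersecting finitely many cones means taking the least
  aperture and the greatest height.\<close>

lemma free_conv_witness_iff:
  assumes "real_prob \<mu>" "real_prob \<nu>" "real_prob \<rho>"
  shows "(\<exists>l N \<phi>\<mu> \<phi>\<nu> \<phi>\<rho>. l > 0 \<and> N > 0 \<and>
        voiculescu_on \<mu> \<phi>\<mu> (tcone l N) \<and> voiculescu_on \<nu> \<phi>\<nu> (tcone l N) \<and>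
        voiculescu_on \<rho> \<phi>\<rho> (tcone l N) \<and> (\<forall>z\<in>tcone l N. \<phi>\<rho> z = \<phi>\<mu> z + \<phi>\<nu> z)) \<longleftrightarrow>
    eventually (\<lambda>v. voiculescu \<rho> v = voiculescu \<mu> v + voiculescu \<nu> v) high_cone" (is "?L \<longleftrightarrow> ?R")
proof
  assume ?L
  then obtain l N \<phi>\<mu> \<phi>\<nu> \<phi>\<rho> where l: "l > 0" and *: "voiculescu_on \<mu> \<phi>\<mu> (tcone l N)"
    "voiculescu_on \<nu> \<phi>\<nu> (tcone l N)" "voiculescu_on \<rho> \<phi>\<rho> (tcone l N)"
    and add: "\<forall>z\<in>tcone l N. \<phi>\<rho> z = \<phi>\<mu> z + \<phi>\<nu> z" by blast
  note ev = real_distribution.voiculescu_on_eq_voiculescu[OF real_probD _ l]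
  show ?R
    using ev[OF assms(1) *(1)] ev[OF assms(2) *(2)] ev[OF assms(3) *(3)] eventually_in_tcone[OF l, of N]
    by eventually_elim (use add in auto)
next
  assume ?R
  then obtain l0 N0 where 0: "l0 > 0" "N0 > 0"
    "\<And>v. v \<in> tcone l0 N0 \<Longrightarrow> voiculescu \<rho> v = voiculescu \<mu> v + voiculescu \<nu> v"
    by (auto simp: eventually_high_cone)
  note ex = real_distribution.voiculescu_on_voiculescu[OF real_probD]
  obtain l1 N1 where 1: "l1 > 0" "N1 > 0" "voiculescu_on \<mu> (voiculescu \<mu>) (tcone l1 N1)"
    using ex[OF assms(1)] by blast
  obtain l2 N2 where 2: "l2 > 0" "N2 > 0" "voiculescu_on \<nu> (voiculescu \<nu>) (tcone l2 N2)"
    using ex[OF assms(2)] by blast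
  obtain l3 N3 where 3: "l3 > 0" "N3 > 0" "voiculescu_on \<rho> (voiculescu \<rho>) (tcone l3 N3)"
    using ex[OF assms(3)] by blast
  define l N where "l = min (min l0 l1) (min l2 l3)" and "N = max (max N0 N1) (max N2 N3)"
  have sub: "tcone l N \<subseteq> tcone l0 N0" "tcone l N \<subseteq> tcone l1 N1" "tcone l N \<subseteq> tcone l2 N2" "tcone l N \<subseteq> tcone l3 N3"
    by (rule tcone_mono; simp add: l_def N_def)+
  have "voiculescu_on \<mu> (voiculescu \<mu>) (tcone l N)" "voiculescu_on \<nu> (voiculescu \<nu>) (tcone l N)"
    "voiculescu_on \<rho> (voiculescu \<rho>) (tcone l N)"
    using 1 2 3 sub by (blast intro: voiculescu_on_subset)+
  moreover have "\<forall>z\<in>tcone l N. voiculescu \<rho> z = voiculescu \<mu> z + voiculescu \<nu> z"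
    using 0 sub by blast
  moreover have "l > 0" "N > 0" using 0 1 2 3 by (auto simp: l_def N_def)
  ultimately show ?L by blast
qed

text \<open>At \<open>v = cauchy_F \<rho> z\<close> the three transforms are \<open>z - v\<close>,
  \<open>cauchy_F \<rho>1 z - v\<close> and \<open>cauchy_F \<rho>2 z - v\<close>; additivity is
  then exactly the equation for the sum of the subordination functions.\<close>

lemma voiculescu_additiveI:
  assumes "real_prob \<mu>" "real_prob \<nu>" "real_prob \<rho>1" "real_prob \<rho>2" "real_prob \<rho>"
    and \<rho>: "\<And>z. Im z > 0 \<Longrightarrow> cauchy_F \<rho> z = cauchy_F \<mu> (cauchy_F \<rho>1 z)"
    and eq: "\<And>z. Im z > 0 \<Longrightarrow> cauchy_F \<mu> (cauchy_F \<rho>1 z) = cauchy_F \<nu> (cauchy_F \<rho>2 z)"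
    and add: "\<And>z. Im z > 0 \<Longrightarrow> cauchy_F \<rho>1 z + cauchy_F \<rho>2 z = z + cauchy_F \<mu> (cauchy_F \<rho>1 z)"
  shows "eventually (\<lambda>v. voiculescu \<rho> v = voiculescu \<mu> v + voiculescu \<nu> v) high_cone"
proof -
  note [intro] = real_probD
  interpret \<mu>: real_distribution \<mu> using assms by blast
  interpret \<nu>: real_distribution \<nu> using assms by blast
  interpret \<rho>1: real_distribution \<rho>1 using assms by blast
  interpret \<rho>2: real_distribution \<rho>2 using assms by blast
  interpret \<rho>: real_distribution \<rho> using assms by blast
  show ?thesis
    unfolding \<rho>.eventually_cauchy_F_iff[of "\<lambda>v. voiculescu \<rho> v = voiculescu \<mu> v + voiculescu \<nu> v", symmetric]
    using \<rho>.voiculescu_cauchy_F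
      eventually_compose_filterlim[OF \<mu>.voiculescu_cauchy_F \<rho>1.filterlim_cauchy_F]
      eventually_compose_filterlim[OF \<nu>.voiculescu_cauchy_F \<rho>2.filterlim_cauchy_F]
      eventually_high_cone_Im_pos
  proof eventually_elim
    case (elim z)
    let ?v = "cauchy_F \<rho> z"
    have v: "cauchy_F \<mu> (cauchy_F \<rho>1 z) = ?v" "cauchy_F \<nu> (cauchy_F \<rho>2 z) = ?v"
      using \<rho>[OF elim(4)] eq[OF elim(4)] by simp_all
    have "voiculescu \<mu> ?v + voiculescu \<nu> ?v = (cauchy_F \<rho>1 z + cauchy_F \<rho>2 z) - ?v - ?v"
      using elim(2,3) unfolding v by simp
    also have "\<dots> = z - ?v" unfolding add[OF elim(4)] v by simp
    finally show ?case using elim(1) by simp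
  qed
qed

section \<open>Existence and uniqueness of the convolutions\<close>

lemma ex_mono_conv:
  assumes "real_prob \<mu>" "real_prob \<nu>"
  shows "\<exists>\<rho>. real_prob \<rho> \<and> (\<forall>z. Im z > 0 \<longrightarrow> cauchy_F \<rho> z = cauchy_F \<mu> (cauchy_F \<nu> z))"
proof -
  interpret \<mu>: real_distribution \<mu> by (rule real_probD) fact
  interpret \<nu>: real_distribution \<nu> by (rule real_probD) fact
  have "(\<lambda>z. cauchy_F \<mu> (cauchy_F \<nu> z)) holomorphic_on {z. Im z > 0}"
    using holomorphic_on_compose_gen[OF \<nu>.holomorphic_cauchy_F \<mu>.holomorphic_cauchy_F] \<nu>.Im_cauchy_F_pos
    by (auto simp: o_def image_subset_iff)
  moreover have "Im (cauchy_F \<mu> (cauchy_F \<nu> z)) \<ge> Im z" if "Im z > 0" for z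
    using \<mu>.Im_cauchy_F_ge[OF \<nu>.Im_cauchy_F_pos[OF that]] \<nu>.Im_cauchy_F_ge[OF that] by simp
  moreover have "asymp_id (\<lambda>z. cauchy_F \<mu> (cauchy_F \<nu> z))"
    by (rule asymp_id_compose[OF \<mu>.asymp_id_cauchy_F \<nu>.asymp_id_cauchy_F])
  ultimately show ?thesis by (rule nevanlinna_cauchy_F)
qed

lemma mono_conv_unique:
  assumes "real_prob \<rho>" "\<And>z. Im z > 0 \<Longrightarrow> cauchy_F \<rho> z = cauchy_F \<mu> (cauchy_F \<nu> z)"
  shows "mono_conv \<mu> \<nu> = \<rho>"
  unfolding mono_conv_def using assms by (intro the_equality) (auto intro: cauchy_F_inject real_probD)

lemma
  assumes "real_prob \<mu>" "real_prob \<nu>"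
  shows real_prob_mono_conv: "real_prob (mono_conv \<mu> \<nu>)"
    and cauchy_F_mono_conv: "Im z > 0 \<Longrightarrow> cauchy_F (mono_conv \<mu> \<nu>) z = cauchy_F \<mu> (cauchy_F \<nu> z)"
  using ex_mono_conv[OF assms] mono_conv_unique by auto

lemma free_conv_unique:
  assumes "real_prob \<mu>" "real_prob \<nu>" "real_prob \<rho>"
    and "eventually (\<lambda>v. voiculescu \<rho> v = voiculescu \<mu> v + voiculescu \<nu> v) high_cone"
  shows "free_conv \<mu> \<nu> = \<rho>"
  unfolding free_conv_def
proof (rule the_equality)
  fix \<rho>' assume "real_prob \<rho>' \<and> (\<exists>l N \<phi>\<mu> \<phi>\<nu> \<phi>\<rho>. l > 0 \<and> N > 0 \<and>
        voiculescu_on \<mu> \<phi>\<mu> (tcone l N) \<and> voiculescu_on \<nu> \<phi>\<nu> (tcone l N) \<and>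
        voiculescu_on \<rho>' \<phi>\<rho> (tcone l N) \<and> (\<forall>z\<in>tcone l N. \<phi>\<rho> z = \<phi>\<mu> z + \<phi>\<nu> z))"
  then have "real_prob \<rho>'" and "eventually (\<lambda>v. voiculescu \<rho>' v = voiculescu \<mu> v + voiculescu \<nu> v) high_cone"
    using free_conv_witness_iff[of \<mu> \<nu> \<rho>'] assms by auto
  moreover from this(2) have "eventually (\<lambda>v. voiculescu \<rho>' v = voiculescu \<rho> v) high_cone"
    using assms(4) by eventually_elim simp
  ultimately show "\<rho>' = \<rho>" using assms by (intro voiculescu_inject)
qed (use assms free_conv_witness_iff in auto)

text \<open>The free convolution is constructed as \<open>mono_conv \<sigma> \<rho>1\<close>, with
  \<open>\<rho>1\<close> the measure of the first subordination function, so one construction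
  settles the existence of both \<open>free_conv\<close> and \<open>subord\<close>.\<close>

lemma ex_free_conv_subord:
  assumes "real_prob \<sigma>" "real_prob \<mu>"
  shows "\<exists>\<rho>. real_prob \<rho> \<and> real_prob (free_conv \<sigma> \<mu>) \<and> free_conv \<sigma> \<mu> = mono_conv \<sigma> \<rho> \<and>
    eventually (\<lambda>v. voiculescu (free_conv \<sigma> \<mu>) v = voiculescu \<sigma> v + voiculescu \<mu> v) high_cone"
proof -
  obtain \<rho>1 \<rho>2 where \<rho>: "real_prob \<rho>1" "real_prob \<rho>2"
    "\<And>z. Im z > 0 \<Longrightarrow> cauchy_F \<sigma> (cauchy_F \<rho>1 z) = cauchy_F \<mu> (cauchy_F \<rho>2 z)"
    "\<And>z. Im z > 0 \<Longrightarrow> cauchy_F \<rho>1 z + cauchy_F \<rho>2 z = z + cauchy_F \<sigma> (cauchy_F \<rho>1 z)"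
    by (rule exists_subordination[OF assms]) blast
  have m: "real_prob (mono_conv \<sigma> \<rho>1)" by (rule real_prob_mono_conv) fact+
  have "eventually (\<lambda>v. voiculescu (mono_conv \<sigma> \<rho>1) v = voiculescu \<sigma> v + voiculescu \<mu> v) high_cone"
    by (rule voiculescu_additiveI[OF assms \<rho>(1,2) m cauchy_F_mono_conv[OF assms(1) \<rho>(1)] \<rho>(3,4)])
  moreover from this have "free_conv \<sigma> \<mu> = mono_conv \<sigma> \<rho>1" by (rule free_conv_unique[OF assms m])
  ultimately show ?thesis using m \<rho>(1) by auto
qed

lemma
  assumes "real_prob \<mu>" "real_prob \<nu>"
  shows real_prob_free_conv: "real_prob (free_conv \<mu> \<nu>)"
    and voiculescu_free_conv:
      "eventually (\<lambda>v. voiculescu (free_conv \<mu> \<nu>) v = voiculescu \<mu> v + voiculescu \<nu> v) high_cone"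
  using ex_free_conv_subord[OF assms] by blast+

text \<open>With \<open>v = cauchy_F \<rho> w\<close>, the point \<open>cauchy_F \<sigma> v\<close> is the value of the reciprocal Cauchy transform of
  \<open>free_conv \<sigma> \<mu>\<close> at \<open>w\<close>, where the three Voiculescu transforms involved are explicit.\<close>

lemma voiculescu_of_subord_equation:
  assumes "real_prob \<sigma>" "real_prob \<mu>" "real_prob \<rho>" and eq: "free_conv \<sigma> \<mu> = mono_conv \<sigma> \<rho>"
  shows "eventually (\<lambda>v. voiculescu \<rho> v = voiculescu \<mu> (cauchy_F \<sigma> v)) high_cone"
proof -
  interpret \<sigma>: real_distribution \<sigma> by (rule real_probD) fact
  interpret \<rho>: real_distribution \<rho> by (rule real_probD) fact
  interpret \<tau>: real_distribution "free_conv \<sigma> \<mu>" by (intro real_probD real_prob_free_conv assms)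
  have F: "cauchy_F (free_conv \<sigma> \<mu>) z = cauchy_F \<sigma> (cauchy_F \<rho> z)" if "Im z > 0" for z
    unfolding eq by (rule cauchy_F_mono_conv) fact+
  show ?thesis
    unfolding \<rho>.eventually_cauchy_F_iff[of "\<lambda>v. voiculescu \<rho> v = voiculescu \<mu> (cauchy_F \<sigma> v)", symmetric]
    using \<rho>.voiculescu_cauchy_F \<tau>.voiculescu_cauchy_F
      eventually_compose_filterlim[OF \<sigma>.voiculescu_cauchy_F \<rho>.filterlim_cauchy_F]
      eventually_compose_filterlim[OF voiculescu_free_conv[OF assms(1,2)] \<tau>.filterlim_cauchy_F]
      eventually_high_cone_Im_pos
  proof eventually_elim
    case (elim w)
    let ?v = "cauchy_F \<rho> w" and ?u = "cauchy_F \<sigma> (cauchy_F \<rho> w)"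
    have "voiculescu \<mu> ?u = voiculescu (free_conv \<sigma> \<mu>) ?u - voiculescu \<sigma> ?u"
      using elim(4) F[OF elim(5)] by simp
    also have "\<dots> = (w - ?u) - (?v - ?u)" using elim(2,3) F[OF elim(5)] by simp
    also have "\<dots> = voiculescu \<rho> ?v" using elim(1) by simp
    finally show ?case ..
  qed
qed

text \<open>The subordination equation prescribes the germ of each of its solutions, so the solution
  is unique and \<open>THE\<close> selects it.\<close>

lemma
  assumes "real_prob \<sigma>" "real_prob \<mu>"
  shows real_prob_subord: "real_prob (subord \<sigma> \<mu>)"
    and voiculescu_subord: "eventually (\<lambda>v. voiculescu (subord \<sigma> \<mu>) v = voiculescu \<mu> (cauchy_F \<sigma> v)) high_cone"
proof -
  obtain \<rho> where \<rho>: "real_prob \<rho>" "free_conv \<sigma> \<mu> = mono_conv \<sigma> \<rho>"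
    using ex_free_conv_subord[OF assms] by blast
  have "subord \<sigma> \<mu> = \<rho>"
    unfolding subord_def
  proof (rule the_equality)
    fix \<rho>' assume \<rho>': "real_prob \<rho>' \<and> free_conv \<sigma> \<mu> = mono_conv \<sigma> \<rho>'"
    then have "eventually (\<lambda>v. voiculescu \<rho>' v = voiculescu \<mu> (cauchy_F \<sigma> v)) high_cone"
      using voiculescu_of_subord_equation[OF assms] by blast
    with voiculescu_of_subord_equation[OF assms \<rho>]
    have "eventually (\<lambda>v. voiculescu \<rho>' v = voiculescu \<rho> v) high_cone"
      by eventually_elim simp
    then show "\<rho>' = \<rho>" using \<rho> \<rho>' by (intro voiculescu_inject) auto
  qed (use \<rho> in simp)
  then show "real_prob (subord \<sigma> \<mu>)"
    and "eventually (\<lambda>v. voiculescu (subord \<sigma> \<mu>) v = voiculescu \<mu> (cauchy_F \<sigma> v)) high_cone"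
    using \<rho> voiculescu_of_subord_equation[OF assms \<rho>] by auto
qed

theorem theorem1p3:
  assumes "real_prob \<mu>1" and "real_prob \<mu>2" and "real_prob \<mu>"
    and "real_prob \<sigma>" and "real_prob \<sigma>1" and "real_prob \<sigma>2"
  shows "subord \<sigma> (free_conv \<mu>1 \<mu>2) = free_conv (subord \<sigma> \<mu>1) (subord \<sigma> \<mu>2) \<and>
         subord \<sigma>1 (subord \<sigma>2 \<mu>) = subord (mono_conv \<sigma>2 \<sigma>1) \<mu>"
proof
  note prob = real_prob_subord real_prob_free_conv real_prob_mono_conv assms
  note lim = real_distribution.filterlim_cauchy_F[OF real_probD]
  \<comment> \<open>Composition on the right with \<open>cauchy_F \<sigma>\<close> is additive in
    the outer function, and \<open>cauchy_F \<sigma>\<close> preserves the filter, so additivity of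
    germs is inherited.\<close>
  have "eventually (\<lambda>v. voiculescu (subord \<sigma> (free_conv \<mu>1 \<mu>2)) v
      = voiculescu (subord \<sigma> \<mu>1) v + voiculescu (subord \<sigma> \<mu>2) v) high_cone"
    using voiculescu_subord[OF assms(4) real_prob_free_conv[OF assms(1,2)]]
      eventually_compose_filterlim[OF voiculescu_free_conv[OF assms(1,2)] lim[OF assms(4)]]
      voiculescu_subord[OF assms(4,1)] voiculescu_subord[OF assms(4,2)]
    by eventually_elim simp
  then show "subord \<sigma> (free_conv \<mu>1 \<mu>2) = free_conv (subord \<sigma> \<mu>1) (subord \<sigma> \<mu>2)"
    by (intro free_conv_unique[symmetric] prob)
  \<comment> \<open>Each subordination composes on the right, so the left side has the germ
    \<open>voiculescu \<mu> (cauchy_F \<sigma>2 (cauchy_F \<sigma>1 v))\<close>; this explains the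
    reversed order in \<open>mono_conv \<sigma>2 \<sigma>1\<close>.\<close>
  have "eventually (\<lambda>v. voiculescu (subord \<sigma>1 (subord \<sigma>2 \<mu>)) v
      = voiculescu (subord (mono_conv \<sigma>2 \<sigma>1) \<mu>) v) high_cone"
    using voiculescu_subord[OF assms(5) real_prob_subord[OF assms(6,3)]]
      eventually_compose_filterlim[OF voiculescu_subord[OF assms(6,3)] lim[OF assms(5)]]
      voiculescu_subord[OF real_prob_mono_conv[OF assms(6,5)] assms(3)] eventually_high_cone_Im_pos
    by eventually_elim (simp add: cauchy_F_mono_conv assms)
  then show "subord \<sigma>1 (subord \<sigma>2 \<mu>) = subord (mono_conv \<sigma>2 \<sigma>1) \<mu>"
    by (intro voiculescu_inject prob)
qed

end
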